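(* Let $T>0$, let $\varepsilon$ be a nonzero real number with $|\varepsilon|<1$, and let $\Omega=\{(x,t): -\pi<x<\pi,\ 0<t<T\}$. Let $\varphi,\psi\in C^2[-\pi,\pi]$ with $\varphi''',\psi'''\in L_2(-\pi,\pi)$ and $\varphi^{(i)}(\pm\pi)=\psi^{(i)}(\pm\pi)=0$ for $i=0,2$. Consider the inverse problem of finding a pair $(u,f)$ with $u\in C^{2,1}_{x,t}(\Omega)$, $f\in C[-\pi,\pi]$, such that $$u_t(x,t)-u_{xx}(x,t)+\varepsilon u_{xx}(-x,t)=f(x),\quad (x,t)\in\Omega,$$ $$u(x,0)=\varphi(x),\quad u(x,T)=\psi(x),\quad x\in[-\pi,\pi],$$ $$u(-\pi,t)=0,\quad u(\pi,t)=0,\quad t\in[0,T].$$ Then a unique solution of this problem exists, and it is given by $$u(x,t)=\varphi(x)+\sum_{k=1}^\infty \frac{1-e^{-(1+\varepsilon)k^2t}}{1-e^{-(1+\varepsilon)k^2T}}\left(\frac{\varphi^{(3)}_{1k}-\psi^{(3)}_{1k}}{k^3}\right)\sin kx-\sum_{k=0}^\infty \frac{1-e^{-(1-\varepsilon)(k+\frac12)^2t}}{1-e^{-(1-\varepsilon)(k+\frac12)^2T}}\left(\frac{\varphi^{(3)}_{2k}-\psi^{(3)}_{2k}}{(k+\frac12)^3}\right)\cos\left(k+\tfrac12\right)x,$$ $$f(x)=-\varphi''(x)+\varepsilon\varphi''(-x)+\sum_{k=1}^\infty \frac{1+\varepsilon}{k}\left(\frac{\varphi^{(3)}_{1k}-\psi^{(3)}_{1k}}{1-e^{-(1+\varepsilon)k^2T}}\right)\sin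 kx-\sum_{k=0}^\infty\frac{1-\varepsilon}{k+\frac12}\left(\frac{\varphi^{(3)}_{2k}-\psi^{(3)}_{2k}}{1-e^{-(1-\varepsilon)(k+\frac12)^2T}}\right)\cos\left(k+\tfrac12\right)x,$$ where $$\varphi^{(3)}_{1k}=\frac1\pi\int_{-\pi}^\pi\varphi'''(x)\cos kx\,dx,\quad \varphi^{(3)}_{2k}=\frac1\pi\int_{-\pi}^\pi\varphi'''(x)\sin\left(k+\tfrac12\right)x\,dx,$$ $$\psi^{(3)}_{1k}=\frac1\pi\int_{-\pi}^\pi\psi'''(x)\cos kx\,dx,\quad \psi^{(3)}_{2k}=\frac1\pi\int_{-\pi}^\pi\psi'''(x)\sin\left(k+\tfrac12\right)x\,dx.$$
   Context: $C^{2,1}_{x,t}(\Omega)$ denotes functions on $\Omega$ that are twice continuously differentiable in $x$ and once continuously differentiable in $t$. A pair $(u,f)$ with $u\in C^{2,1}_{x,t}(\Omega)$, $f\in C[-\pi,\pi]$ satisfying the equation and conditions is called a regular solution.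
   Formalization: Solutions u are additionally required to be continuous on the closed rectangle [-π,π]×[0,T]; with u only in C^{2,1}(Ω), Ω open, the initial, final and boundary values could be prescribed independently of the interior and uniqueness would fail. *)

theory Defs
  imports "HOL-Analysis.Analysis"
begin

definition pdx :: "(real \<Rightarrow> real \<Rightarrow> real) \<Rightarrow> real \<Rightarrow> real \<Rightarrow> real" where
  "pdx u x t = deriv (\<lambda>y. u y t) x"

definition pdxx :: "(real \<Rightarrow> real \<Rightarrow> real) \<Rightarrow> real \<Rightarrow> real \<Rightarrow> real" where
  "pdxx u x t = deriv (\<lambda>y. pdx u y t) x"

definition pdt :: "(real \<Rightarrow> real \<Rightarrow> real) \<Rightarrow> real \<Rightarrow> real \<Rightarrow> real" where
  "pdt u x t = deriv (\<lambda>s. u x s) t"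

definition Omega :: "real \<Rightarrow> (real \<times> real) set" where
  "Omega T = {-pi<..<pi} \<times> {0<..<T}"

definition C21 :: "(real \<Rightarrow> real \<Rightarrow> real) \<Rightarrow> (real \<times> real) set \<Rightarrow> bool" where
  "C21 u S \<longleftrightarrow>
     (\<forall>(x,t)\<in>S. (\<lambda>y. u y t) differentiable (at x)
                \<and> (\<lambda>y. pdx u y t) differentiable (at x)
                \<and> (\<lambda>s. u x s) differentiable (at t))
     \<and> continuous_on S (\<lambda>(x,t). u x t)
     \<and> continuous_on S (\<lambda>(x,t). pdx u x t)
     \<and> continuous_on S (\<lambda>(x,t). pdxx u x t)
     \<and> continuous_on S (\<lambda>(x,t). pdt u x t)"

text \<open>Regular solution (u,f) of the inverse problem. u is additionally required to be
  continuous on the closed rectangle so that the initial/final/boundary conditions are meaningful.\<close>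
definition regular_solution ::
  "real \<Rightarrow> real \<Rightarrow> (real \<Rightarrow> real) \<Rightarrow> (real \<Rightarrow> real) \<Rightarrow> (real \<Rightarrow> real \<Rightarrow> real) \<Rightarrow> (real \<Rightarrow> real) \<Rightarrow> bool"
where
  "regular_solution T \<epsilon> \<phi> \<psi> u f \<longleftrightarrow>
     C21 u (Omega T)
     \<and> continuous_on ({-pi..pi} \<times> {0..T}) (\<lambda>(x,t). u x t)
     \<and> continuous_on {-pi..pi} f
     \<and> (\<forall>(x,t)\<in>Omega T. pdt u x t - pdxx u x t + \<epsilon> * pdxx u (-x) t = f x)
     \<and> (\<forall>x\<in>{-pi..pi}. u x 0 = \<phi> x \<and> u x T = \<psi> x)
     \<and> (\<forall>t\<in>{0..T}. u (-pi) t = 0 \<and> u pi t = 0)"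

definition coef1 :: "(real \<Rightarrow> real) \<Rightarrow> real \<Rightarrow> real" where
  "coef1 g k = (1/pi) * integral {-pi..pi} (\<lambda>x. g x * cos (k * x))"

definition coef2 :: "(real \<Rightarrow> real) \<Rightarrow> real \<Rightarrow> real" where
  "coef2 g k = (1/pi) * integral {-pi..pi} (\<lambda>x. g x * sin ((k + 1/2) * x))"

definition uterm1 :: "real \<Rightarrow> real \<Rightarrow> (real \<Rightarrow> real) \<Rightarrow> (real \<Rightarrow> real) \<Rightarrow> real \<Rightarrow> real \<Rightarrow> nat \<Rightarrow> real" where
  "uterm1 T \<epsilon> \<phi>3 \<psi>3 x t k = (let n = real k in
     (1 - exp (-(1+\<epsilon>) * n^2 * t)) / (1 - exp (-(1+\<epsilon>) * n^2 * T))
     * ((coef1 \<phi>3 n - coef1 \<psi>3 n) / n^3) * sin (n * x))"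

definition uterm2 :: "real \<Rightarrow> real \<Rightarrow> (real \<Rightarrow> real) \<Rightarrow> (real \<Rightarrow> real) \<Rightarrow> real \<Rightarrow> real \<Rightarrow> nat \<Rightarrow> real" where
  "uterm2 T \<epsilon> \<phi>3 \<psi>3 x t k = (let m = real k + 1/2 in
     (1 - exp (-(1-\<epsilon>) * m^2 * t)) / (1 - exp (-(1-\<epsilon>) * m^2 * T))
     * ((coef2 \<phi>3 (real k) - coef2 \<psi>3 (real k)) / m^3) * cos (m * x))"

definition fterm1 :: "real \<Rightarrow> real \<Rightarrow> (real \<Rightarrow> real) \<Rightarrow> (real \<Rightarrow> real) \<Rightarrow> real \<Rightarrow> nat \<Rightarrow> real" where
  "fterm1 T \<epsilon> \<phi>3 \<psi>3 x k = (let n = real k in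
     (1+\<epsilon>) / n * ((coef1 \<phi>3 n - coef1 \<psi>3 n) / (1 - exp (-(1+\<epsilon>) * n^2 * T))) * sin (n * x))"

definition fterm2 :: "real \<Rightarrow> real \<Rightarrow> (real \<Rightarrow> real) \<Rightarrow> (real \<Rightarrow> real) \<Rightarrow> real \<Rightarrow> nat \<Rightarrow> real" where
  "fterm2 T \<epsilon> \<phi>3 \<psi>3 x k = (let m = real k + 1/2 in
     (1-\<epsilon>) / m * ((coef2 \<phi>3 (real k) - coef2 \<psi>3 (real k)) / (1 - exp (-(1-\<epsilon>) * m^2 * T))) * cos (m * x))"

definition u_sol :: "real \<Rightarrow> real \<Rightarrow> (real \<Rightarrow> real) \<Rightarrow> (real \<Rightarrow> real) \<Rightarrow> (real \<Rightarrow> real) \<Rightarrow> real \<Rightarrow> real \<Rightarrow> real" where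
  "u_sol T \<epsilon> \<phi> \<phi>3 \<psi>3 x t =
     \<phi> x + (\<Sum>k. uterm1 T \<epsilon> \<phi>3 \<psi>3 x t (Suc k)) - (\<Sum>k. uterm2 T \<epsilon> \<phi>3 \<psi>3 x t k)"

definition f_sol :: "real \<Rightarrow> real \<Rightarrow> (real \<Rightarrow> real) \<Rightarrow> (real \<Rightarrow> real) \<Rightarrow> (real \<Rightarrow> real) \<Rightarrow> real \<Rightarrow> real" where
  "f_sol T \<epsilon> \<phi>2 \<phi>3 \<psi>3 x =
     - \<phi>2 x + \<epsilon> * \<phi>2 (-x) + (\<Sum>k. fterm1 T \<epsilon> \<phi>3 \<psi>3 x (Suc k)) - (\<Sum>k. fterm2 T \<epsilon> \<phi>3 \<psi>3 x k)"

text \<open>g in C^2[-pi,pi] with g' = g1, g'' = g2 (one-sided at endpoints), and g''' = g3 in L2 in the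
  weak sense: g2 is the indefinite integral of the square-integrable function g3.\<close>
definition C2_L2_third :: "(real \<Rightarrow> real) \<Rightarrow> (real \<Rightarrow> real) \<Rightarrow> (real \<Rightarrow> real) \<Rightarrow> (real \<Rightarrow> real) \<Rightarrow> bool" where
  "C2_L2_third g g1 g2 g3 \<longleftrightarrow>
     (\<forall>x\<in>{-pi..pi}. (g has_real_derivative g1 x) (at x within {-pi..pi})
                   \<and> (g1 has_real_derivative g2 x) (at x within {-pi..pi}))
     \<and> continuous_on {-pi..pi} g2
     \<and> g3 measurable_on {-pi..pi}
     \<and> (\<lambda>x. (g3 x)^2) integrable_on {-pi..pi}
     \<and> (\<forall>x\<in>{-pi..pi}. g2 x = g2 (-pi) + integral {-pi..x} g3)"

end

theory Submission
  imports Defs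
begin

text \<open>The Dirichlet modes of the interval, \<open>sin kx\<close> and \<open>cos (k + 1/2)x\<close>, are odd and even respectively,
  so they also diagonalise \<open>u \<mapsto> - u\<^sub>x\<^sub>x(x) + \<epsilon> u\<^sub>x\<^sub>x(-x)\<close>, with eigenvalues \<open>(1 + \<epsilon>)k\<^sup>2\<close> and
  \<open>(1 - \<epsilon>)(k + 1/2)\<^sup>2\<close>. Each coefficient of a solution satisfies a scalar equation
  \<open>G' = F - \<mu> G\<close> with \<open>G(0)\<close> and \<open>G(T)\<close> prescribed, which determines both the function \<open>G\<close> and the
  constant \<open>F\<close>; completeness of the modes gives uniqueness. Completeness reduces to the Weierstrass
  theorem in the variable \<open>cos x\<close>. For existence, Bessel's inequality for \<open>\<phi>''' - \<psi>'''\<close> makes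
  \<open>\<Sum> |d\<^sub>k| / k\<close> finite, and this dominates all the differentiated series uniformly up to \<open>t = 0\<close>.\<close>

section \<open>Completeness of the two trigonometric families\<close>

text \<open>Writing \<open>u = \<phi> + w\<close>, the remainder \<open>w\<close> vanishes at time 0
  and must equal \<open>\<psi> - \<phi>\<close> at time \<open>T\<close>; the terms in
  \<open>\<phi>''\<close> in the formula for \<open>f\<close> are what \<open>\<phi>\<close> itself
  contributes to the equation. The cubes in the formula come from three integrations by parts: a
  coefficient \<open>d\<close> of \<open>\<phi>''' - \<psi>'''\<close>, divided by the cube of its
  frequency, is the coefficient of \<open>\<psi> - \<phi>\<close> on the corresponding mode (up to
  the sign that the second family carries). One time derivative or two space derivatives cost two
  powers of the frequency and leave \<open>|d| / k\<close>. The assumption on the third derivatives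
  makes \<open>d\<close> square summable, and pairing it with the square summable sequence
  \<open>1 / k\<close> gives the required absolute convergence. Completeness serves existence too:
  the value at time \<open>T\<close> is not read off from a pointwise convergence theorem for
  Fourier series. The uniformly convergent sum is continuous and has the same coefficients as
  \<open>\<psi> - \<phi>\<close>, so the two agree.\<close>

lemma integral_reflect_sym:
  fixes f :: "real \<Rightarrow> real"
  shows "integral {-a..a} (\<lambda>x. f (- x)) = integral {-a..a} f"
  using Henstock_Kurzweil_Integration.integral_reflect_real[of a "-a" f] by simp

lemma integral_odd_eq_0:
  fixes f :: "real \<Rightarrow> real"
  assumes "\<And>x. x \<in> {-a..a} \<Longrightarrow> f (- x) = - f x"
  shows "integral {-a..a} f = 0"
proof -
  have "integral {-a..a} f = integral {-a..a} (\<lambda>x. f (- x))"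
    by (simp add: integral_reflect_sym)
  also have "\<dots> = integral {-a..a} (\<lambda>x. - f x)"
    by (intro integral_cong assms)
  finally show ?thesis by simp
qed

text \<open>Evenness makes \<open>H x\<close> a continuous function of \<open>cos x\<close>, namely
  \<open>H \<circ> arccos\<close> on \<open>[-1, 1]\<close>. A polynomial \<open>g\<close> uniformly
  close to it satisfies \<open>\<integral> H g(cos) = 0\<close>, so
  \<open>\<integral> H^2 = \<integral> H (H - g(cos))\<close> is arbitrarily small.\<close>

lemma even_cos_moments_zero:
  fixes H :: "real \<Rightarrow> real"
  assumes cont: "continuous_on {-pi..pi} H"
    and even: "\<And>x. x \<in> {-pi..pi} \<Longrightarrow> H (- x) = H x"
    and moments: "\<And>n. integral {-pi..pi} (\<lambda>x. H x * cos x ^ n) = 0"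
    and x: "x \<in> {-pi..pi}"
  shows "H x = 0"
proof -
  define K where "K = integral {-pi..pi} (\<lambda>x. \<bar>H x\<bar>)"
  have K: "K \<ge> 0" unfolding K_def by (intro integral_nonneg integrable_continuous_real continuous_intros cont) auto
  have contq: "continuous_on {-1..1} (H \<circ> arccos)"
    by (intro continuous_on_compose continuous_on_arccos' continuous_on_subset[OF cont])
       (auto simp: arccos_lbound arccos_ubound intro!: order_trans[OF _ arccos_lbound, of "- pi"])
  have H_arccos: "H (arccos (cos y)) = H y" if "y \<in> {-pi..pi}" for y
  proof (cases "y \<ge> 0")
    case True with that show ?thesis by (simp add: arccos_cos)
  next
    case False
    with that have "arccos (cos (- y)) = - y" by (intro arccos_cos) auto
    with even[OF that] show ?thesis by simp
  qed
  have "integral {-pi..pi} (\<lambda>x. H x ^ 2) \<le> e" if "e > 0" for e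
  proof -
    \<comment> \<open>The summand 1 keeps the quotient meaningful when \<open>K = 0\<close>, and
      still \<open>d * K \<le> e\<close>.\<close>
    define d where "d = e / (K + 1)"
    have d: "d > 0" using that K by (simp add: d_def)
    obtain g where g: "real_polynomial_function g" "\<And>y. y \<in> {-1..1} \<Longrightarrow> \<bar>(H \<circ> arccos) y - g y\<bar> < d"
      using Stone_Weierstrass_real_polynomial_function[OF _ contq d] by auto
    obtain a n where gs: "g = (\<lambda>y. \<Sum>i\<le>n. a i * y ^ i)"
      using g(1) real_polynomial_function_iff_sum by blast
    have int_g: "(\<lambda>x. H x * g (cos x)) integrable_on {-pi..pi}"
      unfolding gs by (intro integrable_continuous_real continuous_intros cont)
    have "integral {-pi..pi} (\<lambda>x. H x * g (cos x))
        = integral {-pi..pi} (\<lambda>x. \<Sum>i\<le>n. a i * (H x * cos x ^ i))"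
      unfolding gs by (simp add: sum_distrib_left mult_ac)
    also have "\<dots> = (\<Sum>i\<le>n. a i * integral {-pi..pi} (\<lambda>x. H x * cos x ^ i))"
      by (subst integral_sum) (auto intro!: integrable_continuous_real continuous_intros cont)
    finally have g0: "integral {-pi..pi} (\<lambda>x. H x * g (cos x)) = 0" by (simp add: moments)
    have "integral {-pi..pi} (\<lambda>x. H x ^ 2)
        = integral {-pi..pi} (\<lambda>x. H x ^ 2 - H x * g (cos x))"
      by (subst integral_diff) (auto simp: g0 intro!: int_g integrable_continuous_real continuous_intros cont)
    also have "\<dots> \<le> integral {-pi..pi} (\<lambda>x. d * \<bar>H x\<bar>)"
    proof (rule integral_le)
      show "(\<lambda>x. H x ^ 2 - H x * g (cos x)) integrable_on {-pi..pi}"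
        by (intro integrable_diff int_g integrable_continuous_real continuous_intros cont)
      show "(\<lambda>x. d * \<bar>H x\<bar>) integrable_on {-pi..pi}"
        by (intro integrable_continuous_real continuous_intros cont)
      fix y assume y: "y \<in> {-pi..pi}"
      have "\<bar>H y - g (cos y)\<bar> \<le> d"
        using g(2)[of "cos y"] H_arccos[OF y] by simp
      have "H y ^ 2 - H y * g (cos y) = H y * (H y - g (cos y))" by (simp add: algebra_simps power2_eq_square)
      also have "\<dots> \<le> \<bar>H y\<bar> * \<bar>H y - g (cos y)\<bar>" by (metis abs_ge_self abs_mult)
      also have "\<dots> \<le> \<bar>H y\<bar> * d" by (intro mult_left_mono) (use \<open>\<bar>H y - g (cos y)\<bar> \<le> d\<close> in auto)
      finally show "H y ^ 2 - H y * g (cos y) \<le> d * \<bar>H y\<bar>" by (simp add: mult.commute)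
    qed
    also have "\<dots> = d * K" by (simp add: K_def)
    also have "\<dots> \<le> e" using K that by (simp add: d_def field_simps)
    finally show ?thesis .
  qed
  then have "integral {-pi..pi} (\<lambda>x. H x ^ 2) \<le> 0" using field_le_epsilon[of _ 0] by auto
  moreover have "integral {-pi..pi} (\<lambda>x. H x ^ 2) \<ge> 0"
    by (intro integral_nonneg integrable_continuous_real continuous_intros cont) auto
  ultimately have "integral {-pi..pi} (\<lambda>x. H x ^ 2) = 0" by simp
  then have "\<forall>y\<in>{-pi..pi}. H y ^ 2 = 0"
    by (subst (asm) integral_eq_0_iff) (auto intro!: continuous_intros cont)
  with x show ?thesis by simp
qed

text \<open>Multiplying a mode by \<open>cos x\<close> averages the modes with neighbouring
  frequencies, so induction on \<open>n\<close> stays within the family except at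
  \<open>k = 0\<close>, where the frequency \<open>c - 1\<close> appears. \<open>reflect\<close>
  folds that mode back: for the sines it is zero (\<open>s = r = 0\<close>), for the cosines it is
  the mode of frequency 1/2 again (\<open>s = 1\<close>, \<open>r = 0\<close>).\<close>

lemma cos_power_moments_zero:
  fixes h :: "real \<Rightarrow> real"
  assumes cont: "continuous_on {-pi..pi} h"
    and base: "\<And>k. integral {-pi..pi} (\<lambda>x. h x * sin ((real k + c) * x + d)) = 0"
    and reflect: "\<And>x. sin ((c - 1) * x + d) = s * sin (c * x + d) + r * sin ((c + 1) * x + d)"
  shows "integral {-pi..pi} (\<lambda>x. h x * cos x ^ n * sin ((real k + c) * x + d)) = 0"
proof (induction n arbitrary: k)
  case 0
  then show ?case using base by simp
next
  case (Suc n)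
  let ?J = "\<lambda>e. integral {-pi..pi} (\<lambda>x. h x * cos x ^ n * sin (e * x + d))"
  have int: "(\<lambda>x. h x * cos x ^ n * sin (e * x + d)) integrable_on {-pi..pi}" for e
    by (intro integrable_continuous_real continuous_intros cont)
  have prod: "cos x * sin (e * x + d) = sin ((e + 1) * x + d) / 2 + sin ((e - 1) * x + d) / 2" for e x :: real
    using sin_times_cos[of "e * x + d" x] by (simp add: algebra_simps add_divide_distrib)
  have "integral {-pi..pi} (\<lambda>x. h x * cos x ^ Suc n * sin ((real k + c) * x + d))
     = integral {-pi..pi} (\<lambda>x. (h x * cos x ^ n * sin ((real k + c + 1) * x + d)) / 2
          + (h x * cos x ^ n * sin ((real k + c - 1) * x + d)) / 2)"
  proof (rule integral_cong)
    fix x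
    have "h x * cos x ^ Suc n * sin ((real k + c) * x + d)
        = h x * cos x ^ n * (cos x * sin ((real k + c) * x + d))" by simp
    then show "h x * cos x ^ Suc n * sin ((real k + c) * x + d) =
         (h x * cos x ^ n * sin ((real k + c + 1) * x + d)) / 2
          + (h x * cos x ^ n * sin ((real k + c - 1) * x + d)) / 2"
      unfolding prod by (simp add: algebra_simps)
  qed
  also have "\<dots> = ?J (real k + c + 1) / 2 + ?J (real k + c - 1) / 2"
    by (subst integral_add) (auto intro!: int)
  also have "?J (real k + c + 1) = 0" using Suc.IH[of "Suc k"] by (simp add: add_ac)
  also have "?J (real k + c - 1) = 0"
  proof (cases k)
    case (Suc j)
    then show ?thesis using Suc.IH[of j] by (simp add: add_ac)
  next
    case 0
    have "?J (c - 1) = integral {-pi..pi} (\<lambda>x. s * (h x * cos x ^ n * sin (c * x + d))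
         + r * (h x * cos x ^ n * sin ((c + 1) * x + d)))"
      by (intro integral_cong, subst reflect) (simp only: distrib_left mult_ac)
    also have "\<dots> = s * ?J c + r * ?J (c + 1)"
      by (subst integral_add) (auto intro!: integrable_on_mult_right int)
    also have "\<dots> = 0" using Suc.IH[of 0] Suc.IH[of 1] by (simp add: add_ac)
    finally show ?thesis using 0 by simp
  qed
  finally show ?case by simp
qed

text \<open>The lowest modes \<open>sin y\<close> and \<open>cos (y / 2)\<close> serve as weights:
  the odd part of \<open>h\<close> times the first and the even part times the second are even
  functions whose moments against powers of \<open>cos\<close> all vanish. It remains to divide by
  the weights.\<close>

lemma trig_system_complete:
  fixes h :: "real \<Rightarrow> real"
  assumes cont: "continuous_on {-pi..pi} h"
    and sines: "\<And>k. integral {-pi..pi} (\<lambda>x. h x * sin ((real k + 1) * x)) = 0"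
    and cosines: "\<And>k. integral {-pi..pi} (\<lambda>x. h x * cos ((real k + 1/2) * x)) = 0"
    and x: "x \<in> {-pi..pi}"
  shows "h x = 0"
proof -
  have contr: "continuous_on {-pi..pi} (\<lambda>x. h (- x))"
    by (rule continuous_on_compose2[OF cont]) (auto intro!: continuous_intros)
  have odd_part: "(h y - h (- y)) * sin y = 0" if y: "y \<in> {-pi..pi}" for y
  proof (rule even_cos_moments_zero[OF _ _ _ y])
    show "continuous_on {-pi..pi} (\<lambda>y. (h y - h (- y)) * sin y)"
      by (intro continuous_intros cont contr)
    fix n
    let ?f = "\<lambda>y. h y * cos y ^ n * sin y"
    have f0: "integral {-pi..pi} ?f = 0"
      using cos_power_moments_zero[OF cont, of 1 0 0 0 n 0] sines by simp
    have "integral {-pi..pi} (\<lambda>y. (h y - h (- y)) * sin y * cos y ^ n)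
       = integral {-pi..pi} (\<lambda>y. ?f y + ?f (- y))"
      by (intro integral_cong) (simp add: algebra_simps)
    also have "\<dots> = integral {-pi..pi} ?f + integral {-pi..pi} (\<lambda>y. ?f (- y))"
      by (rule integral_add; intro integrable_continuous_real continuous_intros cont contr)
    also have "\<dots> = 0" using f0 integral_reflect_sym[of pi ?f] by simp
    finally show "integral {-pi..pi} (\<lambda>y. (h y - h (- y)) * sin y * cos y ^ n) = 0" .
  qed (auto simp: algebra_simps)
  have even_part: "(h y + h (- y)) * cos (y / 2) = 0" if y: "y \<in> {-pi..pi}" for y
  proof (rule even_cos_moments_zero[OF _ _ _ y])
    show "continuous_on {-pi..pi} (\<lambda>y. (h y + h (- y)) * cos (y / 2))"
      by (intro continuous_intros cont contr) auto
    fix n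
    let ?f = "\<lambda>y. h y * cos y ^ n * cos (y / 2)"
    have shift: "sin (a + pi / 2) = cos a" for a :: real by (simp add: sin_add)
    have "integral {-pi..pi} (\<lambda>x. h x * sin ((real k + 1/2) * x + pi / 2)) = 0" for k
      using cosines[of k] by (simp only: shift)
    moreover have "sin ((1/2 - 1) * x + pi / 2) = 1 * sin (1/2 * x + pi / 2) + 0 * sin ((1/2 + 1) * x + pi/2)"
      for x :: real
    proof -
      have "(1/2 - 1) * x = - (1/2 * x)" by simp
      then show ?thesis by (simp only: shift cos_minus)
    qed
    ultimately have "integral {-pi..pi} (\<lambda>x. h x * cos x ^ n * sin ((real 0 + 1/2) * x + pi / 2)) = 0"
      by (rule cos_power_moments_zero[OF cont])
    then have f0: "integral {-pi..pi} ?f = 0" by (simp only: shift) simp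
    have "integral {-pi..pi} (\<lambda>y. (h y + h (- y)) * cos (y / 2) * cos y ^ n)
       = integral {-pi..pi} (\<lambda>y. ?f y + ?f (- y))"
      by (intro integral_cong) (simp add: algebra_simps)
    also have "\<dots> = integral {-pi..pi} ?f + integral {-pi..pi} (\<lambda>y. ?f (- y))"
      by (rule integral_add; intro integrable_continuous_real continuous_intros cont contr) auto
    also have "\<dots> = 0" using f0 integral_reflect_sym[of pi ?f] by simp
    finally show "integral {-pi..pi} (\<lambda>y. (h y + h (- y)) * cos (y / 2) * cos y ^ n) = 0" .
  qed (auto simp: algebra_simps)
  have interior: "h y = 0" if y: "y \<in> {-pi<..<pi}" for y
  proof -
    have "cos (y / 2) > 0" using y by (intro cos_gt_zero_pi) auto
    then have "h y + h (- y) = 0" using even_part[of y] y by auto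
    moreover have "h y - h (- y) = 0"
    proof (cases "y = 0")
      case False
      then have "sin y \<noteq> 0" using y sin_eq_0_pi by force
      then show ?thesis using odd_part[of y] y by auto
    qed simp
    ultimately show ?thesis by simp
  qed
  \<comment> \<open>Both weights vanish at the endpoints, so the values of \<open>h\<close> there
    are recovered by continuity.\<close>
  have "x \<in> closure {-pi<..<pi}" using x by (simp add: closure_greaterThanLessThan)
  then show ?thesis
    using continuous_constant_on_closure[of "{-pi<..<pi}" h 0] cont interior
    by (simp add: closure_greaterThanLessThan)
qed

section \<open>Square-integrable third derivatives\<close>

lemma absolutely_integrable_times_continuous:
  fixes g h :: "real \<Rightarrow> real"
  assumes "g absolutely_integrable_on {a..b}" and h: "continuous_on {a..b} h"
  shows "(\<lambda>x. g x * h x) absolutely_integrable_on {a..b}"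
proof -
  have "(\<lambda>x. h x * g x) absolutely_integrable_on {a..b}"
  proof (rule absolutely_integrable_bounded_measurable_product_real)
    show "h \<in> borel_measurable (lebesgue_on {a..b})"
      by (intro continuous_imp_measurable_on_sets_lebesgue h) auto
    show "bounded (h ` {a..b})" by (intro compact_imp_bounded compact_continuous_image h) auto
  qed (use assms in auto)
  then show ?thesis by (simp add: mult.commute)
qed

text \<open>The function \<open>g\<close> need not be differentiable anywhere, so the product rule is replaced by
  the estimate \<open>|\<Delta>\<Phi>| \<le> 2 L |\<Delta>x| |\<Delta>V|\<close> for the defect \<open>\<Phi>\<close> of the formula, where \<open>V\<close> is the
  (continuous) indefinite integral of \<open>|g|\<close>; hence \<open>\<Phi>\<close> has derivative zero.\<close>

lemma integral_by_parts_indefinite: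
  fixes g e e' G :: "real \<Rightarrow> real"
  assumes ab: "a \<le> b"
    and abs_g: "g absolutely_integrable_on {a..b}"
    and G: "\<And>x. x \<in> {a..b} \<Longrightarrow> G x = G a + integral {a..x} g"
    and e: "\<And>x. (e has_real_derivative e' x) (at x)"
    and e'_cont: "continuous_on UNIV e'"
  shows "integral {a..b} (\<lambda>x. g x * e x) = G b * e b - G a * e a - integral {a..b} (\<lambda>x. G x * e' x)"
proof -
  have e_cont: "continuous_on UNIV e"
    by (intro continuous_at_imp_continuous_on ballI DERIV_isCont[OF e])
  note e_conts[continuous_intros] = continuous_on_subset[OF e_cont subset_UNIV] continuous_on_subset[OF e'_cont subset_UNIV]
  have g_int: "g integrable_on {c..d}" and ag_int: "(\<lambda>x. \<bar>g x\<bar>) integrable_on {c..d}"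
    if "{c..d} \<subseteq> {a..b}" for c d
    using absolutely_integrable_on_subinterval[OF abs_g that] by (auto simp: absolutely_integrable_on_def)
  have G_cont: "continuous_on {a..b} G"
  proof (rule continuous_on_eq[OF _ G[symmetric]])
    show "continuous_on {a..b} (\<lambda>x. G a + integral {a..x} g)"
      by (intro continuous_intros indefinite_integral_continuous_1 g_int) auto
  qed
  have ge_int: "(\<lambda>x. g x * h x) integrable_on {c..d}"
    if "{c..d} \<subseteq> {a..b}" "continuous_on {c..d} h" for c d h
    using absolutely_integrable_times_continuous[OF absolutely_integrable_on_subinterval[OF abs_g that(1)] that(2)]
    by (simp add: absolutely_integrable_on_def)
  define V where "V x = integral {a..x} (\<lambda>x. \<bar>g x\<bar>)" for x
  have V_cont: "continuous_on {a..b} V"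
    unfolding V_def by (intro indefinite_integral_continuous_1 ag_int) auto
  have "bounded (e' ` {a..b})" by (intro compact_imp_bounded compact_continuous_image continuous_intros) auto
  then obtain L where L: "\<And>x. x \<in> {a..b} \<Longrightarrow> \<bar>e' x\<bar> \<le> L"
    by (metis bounded_iff imageI real_norm_def)
  have L0: "L \<ge> 0" using L[of a] ab by auto
  define \<Phi> where "\<Phi> x = integral {a..x} (\<lambda>x. g x * e x) - (G x * e x - integral {a..x} (\<lambda>x. G x * e' x))" for x
  have lip: "\<bar>e t - e s\<bar> \<le> L * (t - s)" if "a \<le> s" "s \<le> t" "t \<le> b" for s t
  proof (cases "s = t")
    case False
    with that have "s < t" by simp
    then obtain z where "s < z" "z < t" "e t - e s = (t - s) * e' z"
      using MVT2[of s t e e'] e by blast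
    then show ?thesis using L[of z] that by (simp add: abs_mult mult.commute mult_right_mono)
  qed auto
  have incr: "\<bar>\<Phi> t - \<Phi> s\<bar> \<le> 2 * L * (t - s) * (V t - V s)" if st: "a \<le> s" "s \<le> t" "t \<le> b" for s t
  proof -
    have sub: "{s..t} \<subseteq> {a..b}" using st by auto
    have comb: "integral {a..t} f - integral {a..s} f = integral {s..t} f"
      if "f integrable_on {a..t}" for f :: "real \<Rightarrow> real"
      using Henstock_Kurzweil_Integration.integral_combine[OF st(1,2) that] by simp
    have dG: "G t - G s = integral {s..t} g"
      using G[of s] G[of t] comb[of g] g_int[of a t] st by auto
    have dV: "V t - V s = integral {s..t} (\<lambda>x. \<bar>g x\<bar>)"
      unfolding V_def using comb[OF ag_int[of a t]] st by auto
    have GG: "\<bar>G x - G s\<bar> \<le> V t - V s" if x: "x \<in> {s..t}" for x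
    proof -
      have "G x - G s = integral {s..x} g"
        using G[of s] G[of x] Henstock_Kurzweil_Integration.integral_combine[of a s x g] g_int[of a x] st x by auto
      also have "\<bar>\<dots>\<bar> \<le> integral {s..x} (\<lambda>x. \<bar>g x\<bar>)"
        using integral_norm_bound_integral[of g "{s..x}" "\<lambda>x. \<bar>g x\<bar>"] g_int[of s x] ag_int[of s x] st x by auto
      also have "\<dots> \<le> integral {s..t} (\<lambda>x. \<bar>g x\<bar>)"
        by (intro integral_subset_le ag_int) (use st x in auto)
      finally show ?thesis by (simp add: dV)
    qed
    have int1: "(\<lambda>x. g x * e x) integrable_on {a..t}" by (intro ge_int continuous_intros) (use st in auto)
    have int2: "(\<lambda>x. G x * e' x) integrable_on {a..t}"
      by (intro integrable_continuous_real continuous_intros continuous_on_subset[OF G_cont]) (use st in auto)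
    have e'_int: "integral {s..t} e' = e t - e s"
      by (intro integral_unique fundamental_theorem_of_calculus st)
         (auto intro!: has_field_derivative_at_within e simp flip: has_real_derivative_iff_has_vector_derivative)
    have A: "integral {s..t} (\<lambda>x. g x * (e x - e t)) = integral {s..t} (\<lambda>x. g x * e x) - (G t - G s) * e t"
    proof -
      have "integral {s..t} (\<lambda>x. g x * (e x - e t)) = integral {s..t} (\<lambda>x. g x * e x - g x * e t)"
        by (simp add: algebra_simps)
      also have "\<dots> = integral {s..t} (\<lambda>x. g x * e x) - integral {s..t} (\<lambda>x. g x * e t)"
        by (intro integral_diff ge_int sub continuous_intros)
      finally show ?thesis by (simp add: dG)
    qed
    have B: "integral {s..t} (\<lambda>x. (G x - G s) * e' x) = integral {s..t} (\<lambda>x. G x * e' x) - G s * (e t - e s)"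
    proof -
      have "integral {s..t} (\<lambda>x. (G x - G s) * e' x) = integral {s..t} (\<lambda>x. G x * e' x - G s * e' x)"
        by (simp add: algebra_simps)
      also have "\<dots> = integral {s..t} (\<lambda>x. G x * e' x) - integral {s..t} (\<lambda>x. G s * e' x)"
        by (intro integral_diff integrable_continuous_real continuous_intros continuous_on_subset[OF G_cont sub])
      finally show ?thesis by (simp add: e'_int)
    qed
    \<comment> \<open>Centring \<open>e\<close> at \<open>e t\<close> and \<open>G\<close> at
      \<open>G s\<close> absorbs all boundary terms. In each remaining integral one factor is
      controlled by \<open>t - s\<close> and the other by \<open>V t - V s\<close>, which gives a
      product of two small increments.\<close>
    have "\<Phi> t - \<Phi> s = integral {s..t} (\<lambda>x. g x * (e x - e t)) + integral {s..t} (\<lambda>x. (G x - G s) * e' x)"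
      unfolding \<Phi>_def A B using comb[OF int1] comb[OF int2] by (simp add: algebra_simps)
    moreover have "\<bar>integral {s..t} (\<lambda>x. g x * (e x - e t))\<bar> \<le> L * (t - s) * (V t - V s)"
    proof -
      have "norm (integral {s..t} (\<lambda>x. g x * (e x - e t))) \<le> integral {s..t} (\<lambda>x. L * (t - s) * \<bar>g x\<bar>)"
      proof (rule integral_norm_bound_integral)
        fix x assume x: "x \<in> {s..t}"
        have "\<bar>e x - e t\<bar> \<le> L * (t - x)" using lip[of x t] x st by (auto simp: abs_minus_commute)
        also have "\<dots> \<le> L * (t - s)" using x L0 by (intro mult_left_mono) auto
        finally show "norm (g x * (e x - e t)) \<le> L * (t - s) * \<bar>g x\<bar>"
          using mult_left_mono[of "\<bar>e x - e t\<bar>" "L * (t - s)" "\<bar>g x\<bar>"] by (simp add: abs_mult mult.commute)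
      qed (intro ge_int sub continuous_intros integrable_on_mult_right ag_int)+
      then show ?thesis by (simp add: dV)
    qed
    moreover have "\<bar>integral {s..t} (\<lambda>x. (G x - G s) * e' x)\<bar> \<le> L * (t - s) * (V t - V s)"
    proof -
      have "norm (integral {s..t} (\<lambda>x. (G x - G s) * e' x)) \<le> integral {s..t} (\<lambda>x. (V t - V s) * L)"
      proof (rule integral_norm_bound_integral)
        fix x assume x: "x \<in> {s..t}"
        show "norm ((G x - G s) * e' x) \<le> (V t - V s) * L"
          using GG[OF x] L[of x] x sub by (auto simp: abs_mult intro!: mult_mono)
      qed (intro integrable_continuous_real continuous_intros continuous_on_subset[OF G_cont sub])+
      then show ?thesis using st by (simp add: algebra_simps)
    qed
    ultimately show ?thesis by simp
  qed
  have incr': "\<bar>\<Phi> t - \<Phi> s\<bar> \<le> 2 * L * \<bar>t - s\<bar> * \<bar>V t - V s\<bar>" if "s \<in> {a..b}" "t \<in> {a..b}" for s t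
  proof (cases "s \<le> t")
    case True
    then have "\<bar>\<Phi> t - \<Phi> s\<bar> \<le> 2 * L * (t - s) * (V t - V s)" using incr that by auto
    also have "\<dots> \<le> 2 * L * \<bar>t - s\<bar> * \<bar>V t - V s\<bar>" using True L0 by (auto intro!: mult_left_mono)
    finally show ?thesis .
  next
    case False
    then have "\<bar>\<Phi> s - \<Phi> t\<bar> \<le> 2 * L * (s - t) * (V s - V t)" using incr that by auto
    also have "\<dots> \<le> 2 * L * \<bar>t - s\<bar> * \<bar>V t - V s\<bar>" using False L0 by (auto intro!: mult_left_mono)
    finally show ?thesis by (simp add: abs_minus_commute)
  qed
  have "(\<Phi> has_real_derivative 0) (at s within {a..b})" if s: "s \<in> {a..b}" for s
    unfolding has_field_derivative_iff
  proof (rule Lim_null_comparison)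
    show "\<forall>\<^sub>F t in at s within {a..b}. norm ((\<Phi> t - \<Phi> s) / (t - s)) \<le> 2 * L * \<bar>V t - V s\<bar>"
      unfolding eventually_at_filter
    proof (intro always_eventually allI impI)
      fix t assume "t \<noteq> s" "t \<in> {a..b}"
      then show "norm ((\<Phi> t - \<Phi> s) / (t - s)) \<le> 2 * L * \<bar>V t - V s\<bar>"
        using incr'[OF s, of t] by (simp add: divide_simps mult_ac)
    qed
    have "(V \<longlongrightarrow> V s) (at s within {a..b})" using V_cont s by (auto simp: continuous_on_def)
    then have "((\<lambda>t. 2 * L * \<bar>V t - V s\<bar>) \<longlongrightarrow> 2 * L * \<bar>V s - V s\<bar>) (at s within {a..b})"
      by (intro tendsto_intros)
    then show "((\<lambda>t. 2 * L * \<bar>V t - V s\<bar>) \<longlongrightarrow> 0) (at s within {a..b})" by simp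
  qed
  then have "\<exists>c. \<forall>x\<in>{a..b}. \<Phi> x = c"
    by (intro has_field_derivative_zero_constant) auto
  then have "\<Phi> b = \<Phi> a" using ab by (metis atLeastAtMost_iff order_refl)
  then show ?thesis by (simp add: \<Phi>_def)
qed

lemma integral_by_parts_smooth:
  fixes g e e' G :: "real \<Rightarrow> real"
  assumes ab: "a \<le> b"
    and G: "\<And>x. x \<in> {a..b} \<Longrightarrow> (G has_real_derivative g x) (at x within {a..b})"
    and g: "continuous_on {a..b} g"
    and e: "\<And>x. (e has_real_derivative e' x) (at x)"
    and e'_cont: "continuous_on UNIV e'"
  shows "integral {a..b} (\<lambda>x. g x * e x) = G b * e b - G a * e a - integral {a..b} (\<lambda>x. G x * e' x)"
proof (rule integral_by_parts_indefinite[OF ab _ _ e e'_cont])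
  show "g absolutely_integrable_on {a..b}" by (rule absolutely_integrable_continuous_real[OF g])
  fix x assume x: "x \<in> {a..b}"
  have "(g has_integral (G x - G a)) {a..x}"
  proof (rule fundamental_theorem_of_calculus)
    fix y assume "y \<in> {a..x}"
    then have "(G has_real_derivative g y) (at y within {a..x})"
      using x by (intro DERIV_subset[OF G[of y]]) auto
    then show "(G has_vector_derivative g y) (at y within {a..x})"
      by (simp add: has_real_derivative_iff_has_vector_derivative)
  qed (use x in auto)
  then show "G x = G a + integral {a..x} g" by (simp add: integral_unique)
qed

lemma square_integrable_imp_absolutely_integrable:
  fixes g :: "real \<Rightarrow> real"
  assumes "g measurable_on {a..b}" and "(\<lambda>x. (g x)\<^sup>2) integrable_on {a..b}"
  shows "g absolutely_integrable_on {a..b}"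
proof (rule measurable_bounded_by_integrable_imp_absolutely_integrable)
  show "g \<in> borel_measurable (lebesgue_on {a..b})"
    using assms(1) by (simp add: measurable_on_iff_borel_measurable)
  show "(\<lambda>x. 1 + (g x)\<^sup>2) integrable_on {a..b}" by (intro integrable_add assms) auto
  fix x
  have "0 \<le> (\<bar>g x\<bar> - 1)\<^sup>2" by simp
  then have "2 * \<bar>g x\<bar> \<le> 1 + (g x)\<^sup>2" by (simp add: power2_diff)
  then show "norm (g x) \<le> 1 + (g x)\<^sup>2" by simp
qed auto

lemma square_integrable_diff:
  fixes f g :: "real \<Rightarrow> real"
  assumes f: "f measurable_on {a..b}" "(\<lambda>x. (f x)\<^sup>2) integrable_on {a..b}"
    and g: "g measurable_on {a..b}" "(\<lambda>x. (g x)\<^sup>2) integrable_on {a..b}"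
  shows "(\<lambda>x. f x - g x) measurable_on {a..b}" "(\<lambda>x. (f x - g x)\<^sup>2) integrable_on {a..b}"
proof -
  have meas: "f \<in> borel_measurable (lebesgue_on {a..b})" "g \<in> borel_measurable (lebesgue_on {a..b})"
    using f(1) g(1) by (simp_all add: measurable_on_iff_borel_measurable)
  then show "(\<lambda>x. f x - g x) measurable_on {a..b}"
    by (simp add: measurable_on_iff_borel_measurable)
  have "(\<lambda>x. (f x - g x)\<^sup>2) absolutely_integrable_on {a..b}"
  proof (rule measurable_bounded_by_integrable_imp_absolutely_integrable)
    show "(\<lambda>x. (f x - g x)\<^sup>2) \<in> borel_measurable (lebesgue_on {a..b})" using meas by measurable
    show "(\<lambda>x. 2 * (f x)\<^sup>2 + 2 * (g x)\<^sup>2) integrable_on {a..b}"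
      by (intro integrable_add integrable_on_mult_right f g)
    fix x
    have "0 \<le> (f x + g x)\<^sup>2" by simp
    then have "(f x - g x)\<^sup>2 \<le> 2 * (f x)\<^sup>2 + 2 * (g x)\<^sup>2"
      by (simp add: power2_eq_square algebra_simps)
    then show "norm ((f x - g x)\<^sup>2) \<le> 2 * (f x)\<^sup>2 + 2 * (g x)\<^sup>2" by simp
  qed auto
  then show "(\<lambda>x. (f x - g x)\<^sup>2) integrable_on {a..b}" by (simp add: absolutely_integrable_on_def)
qed

text \<open>The projection \<open>s\<close> of \<open>g\<close> onto the first \<open>n\<close>
  functions has the same inner products with them as \<open>g\<close>, so expanding
  \<open>\<integral> (g - s)^2 \<ge> 0\<close> leaves \<open>\<integral> g^2\<close> minus the sum
  of the squared coefficients over \<open>p\<close>.\<close>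

lemma Bessel_inequality:
  fixes g :: "real \<Rightarrow> real" and e :: "nat \<Rightarrow> real \<Rightarrow> real"
  assumes g: "g measurable_on {a..b}" "(\<lambda>x. (g x)\<^sup>2) integrable_on {a..b}"
    and e: "\<And>k. continuous_on {a..b} (e k)"
    and orth: "\<And>j k. integral {a..b} (\<lambda>x. e j x * e k x) = (if j = k then p else 0)"
    and p: "p > 0"
  shows "summable (\<lambda>k. (integral {a..b} (\<lambda>x. g x * e k x))\<^sup>2)"
proof -
  define d where "d k = integral {a..b} (\<lambda>x. g x * e k x)" for k
  have ge: "(\<lambda>x. g x * h x) integrable_on {a..b}" if "continuous_on {a..b} h" for h
    using absolutely_integrable_times_continuous[OF square_integrable_imp_absolutely_integrable[OF g] that]
    by (simp add: absolutely_integrable_on_def)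
  have bound: "(\<Sum>k<n. (d k)\<^sup>2) \<le> p * integral {a..b} (\<lambda>x. (g x)\<^sup>2)" for n
  proof -
    define s where "s x = (\<Sum>k<n. d k / p * e k x)" for x
    have s_cont: "continuous_on {a..b} s" unfolding s_def by (intro continuous_intros e) (use p in auto)
    have gs: "integral {a..b} (\<lambda>x. g x * s x) = (\<Sum>k<n. (d k)\<^sup>2) / p"
    proof -
      have "integral {a..b} (\<lambda>x. g x * s x) = integral {a..b} (\<lambda>x. \<Sum>k<n. d k / p * (g x * e k x))"
        unfolding s_def sum_distrib_left by (simp add: mult_ac)
      also have "\<dots> = (\<Sum>k<n. d k / p * d k)"
        unfolding d_def by (subst integral_sum) (auto intro!: integrable_on_mult_right ge e simp del: times_divide_eq_left)
      finally show ?thesis by (simp add: sum_divide_distrib power2_eq_square)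
    qed
    have es: "integral {a..b} (\<lambda>x. e j x * s x) = d j" if "j < n" for j
    proof -
      have "integral {a..b} (\<lambda>x. e j x * s x) = integral {a..b} (\<lambda>x. \<Sum>k<n. d k / p * (e j x * e k x))"
        unfolding s_def sum_distrib_left by (simp add: mult_ac)
      also have "\<dots> = (\<Sum>k<n. d k / p * integral {a..b} (\<lambda>x. e j x * e k x))"
        by (subst integral_sum) (auto intro!: integrable_on_mult_right integrable_continuous_real continuous_intros e simp del: times_divide_eq_left)
      also have "\<dots> = d j" using that p by (simp add: orth if_distrib cong: if_cong)
      finally show ?thesis .
    qed
    have ss: "integral {a..b} (\<lambda>x. s x * s x) = (\<Sum>k<n. (d k)\<^sup>2) / p"
    proof -
      have "integral {a..b} (\<lambda>x. s x * s x) = integral {a..b} (\<lambda>x. \<Sum>k<n. d k / p * (e k x * s x))"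
      proof (rule integral_cong)
        fix x
        have "s x * s x = (\<Sum>k<n. d k / p * e k x) * s x" by (simp add: s_def)
        then show "s x * s x = (\<Sum>k<n. d k / p * (e k x * s x))" by (simp add: sum_distrib_right mult.assoc)
      qed
      also have "\<dots> = (\<Sum>k<n. d k / p * integral {a..b} (\<lambda>x. e k x * s x))"
        by (subst integral_sum) (auto intro!: integrable_on_mult_right integrable_continuous_real continuous_intros e s_cont simp del: times_divide_eq_left)
      also have "\<dots> = (\<Sum>k<n. d k / p * d k)" by (intro sum.cong) (simp_all add: es)
      finally show ?thesis by (simp add: sum_divide_distrib power2_eq_square)
    qed
    have ints: "(\<lambda>x. g x * s x) integrable_on {a..b}" "(\<lambda>x. s x * s x) integrable_on {a..b}"
      by (intro ge s_cont, intro integrable_continuous_real continuous_intros s_cont)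
    have "0 \<le> integral {a..b} (\<lambda>x. ((g x)\<^sup>2 - 2 * (g x * s x)) + s x * s x)"
    proof (rule integral_nonneg)
      fix x
      have "((g x)\<^sup>2 - 2 * (g x * s x)) + s x * s x = (g x - s x)\<^sup>2"
        by (simp add: power2_eq_square algebra_simps)
      then show "0 \<le> ((g x)\<^sup>2 - 2 * (g x * s x)) + s x * s x" by simp
    qed (intro integrable_add integrable_diff integrable_on_mult_right g ints)
    also have "\<dots> = integral {a..b} (\<lambda>x. (g x)\<^sup>2) - 2 * integral {a..b} (\<lambda>x. g x * s x) + integral {a..b} (\<lambda>x. s x * s x)"
      by (subst integral_add, intro integrable_diff integrable_on_mult_right g ints, rule ints,
          subst integral_diff) (auto intro!: integrable_on_mult_right g ints)
    finally show ?thesis unfolding gs ss using p by (simp add: field_simps)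
  qed
  have "summable (\<lambda>k. (d k)\<^sup>2)"
    by (rule bounded_imp_summable[where B = "p * integral {a..b} (\<lambda>x. (g x)\<^sup>2)"])
       (use bound[of "Suc _"] in \<open>auto simp: lessThan_Suc_atMost\<close>)
  then show ?thesis unfolding d_def .
qed

section \<open>The trigonometric families\<close>

text \<open>The modes \<open>sin ((k + c) x + \<theta>)\<close> are \<open>sin (k + 1) x\<close> for \<open>(c, \<theta>) = (1, 0)\<close> and
  \<open>cos (k + 1/2) x\<close> for \<open>(c, \<theta>) = (1/2, \<pi>/2)\<close>.\<close>

definition trig_family :: "real \<Rightarrow> real \<Rightarrow> bool" where
  "trig_family c \<theta> \<longleftrightarrow> (c = 1 \<and> \<theta> = 0) \<or> (c = 1/2 \<and> \<theta> = pi / 2)"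

lemma trig_familyI: "trig_family 1 0" "trig_family (1/2) (pi/2)"
  by (auto simp: trig_family_def)

lemma sin_add_half_pi: "sin (x + pi / 2) = cos x" and cos_add_half_pi: "cos (x + pi / 2) = - sin x"
  for x :: real
  by (simp_all add: sin_add cos_add)

lemma cos_half_integer_pi: "cos ((real k + 1/2) * pi) = 0"
  by (simp add: distrib_right cos_add)

lemma sin_integer_pi: "sin ((real k + 1) * pi) = 0"
  using sin_npi[of "Suc k"] by (simp add: add.commute)

lemma trig_family_vanish:
  assumes "trig_family c \<theta>"
  shows "sin ((real k + c) * pi + \<theta>) = 0" "sin ((real k + c) * (- pi) + \<theta>) = 0"
  using assms sin_integer_pi[of k] cos_half_integer_pi[of k] unfolding trig_family_def
  by (elim disjE conjE; simp only: sin_add_half_pi mult_minus_right cos_minus sin_minus add_0_right minus_zero)+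

lemma integral_cos_full_period:
  assumes "a \<noteq> 0" and "sin (a * pi) = 0"
  shows "integral {-pi..pi} (\<lambda>x. cos (a * x + b)) = 0"
proof -
  have "((\<lambda>x. cos (a * x + b)) has_integral (sin (a * pi + b) / a - sin (a * (-pi) + b) / a)) {-pi..pi}"
    by (rule fundamental_theorem_of_calculus)
       (use assms(1) in \<open>auto simp flip: has_real_derivative_iff_has_vector_derivative intro!: derivative_eq_intros\<close>)
  then show ?thesis using assms by (simp only: mult_minus_right sin_add sin_minus cos_minus) (simp add: integral_unique)
qed

text \<open>Even when the frequencies are half-integers, their differences and sums are integers,
  because \<open>2 * c\<close> is 2 or 1. This is what \<open>integral_cos_full_period\<close> needs
  after a product of modes is split.\<close>

lemma trig_family_freq:
  assumes "trig_family c \<theta>"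
  shows "sin (((real j + c) - (real k + c)) * pi) = 0" "sin (((real j + c) + (real k + c)) * pi) = 0"
    "(real j + c) + (real k + c) \<noteq> 0"
proof -
  have "(real j + c) - (real k + c) = of_int (int j - int k)" by simp
  then show "sin (((real j + c) - (real k + c)) * pi) = 0"
    unfolding sin_zero_iff_int2 by (intro exI arg_cong[where f = "\<lambda>x. x * pi"])
  have "(real j + c) + (real k + c) = of_int (int j + int k + (if c = 1 then 2 else 1))"
    using assms by (auto simp: trig_family_def)
  then show "sin (((real j + c) + (real k + c)) * pi) = 0"
    unfolding sin_zero_iff_int2 by (intro exI arg_cong[where f = "\<lambda>x. x * pi"])
  show "(real j + c) + (real k + c) \<noteq> 0" using assms by (auto simp: trig_family_def)
qed

text \<open>Two versions are needed: the sines are the modes of the solution, while the cosines are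
  their derivatives, against which the third derivatives are tested in Bessel's inequality.\<close>

lemma trig_family_orthogonal:
  assumes fam: "trig_family c \<theta>"
  shows "integral {-pi..pi} (\<lambda>x. cos ((real j + c) * x + \<theta>) * cos ((real k + c) * x + \<theta>)) = (if j = k then pi else 0)"
    and "integral {-pi..pi} (\<lambda>x. sin ((real j + c) * x + \<theta>) * sin ((real k + c) * x + \<theta>)) = (if j = k then pi else 0)"
proof -
  let ?m = "(real j + c) - (real k + c)" and ?p = "(real j + c) + (real k + c)"
  have m: "integral {-pi..pi} (\<lambda>x. cos (?m * x)) = (if j = k then 2 * pi else 0)"
    using integral_cos_full_period[of ?m 0] trig_family_freq(1)[OF fam] by auto
  have p: "integral {-pi..pi} (\<lambda>x. cos (?p * x + 2 * \<theta>)) = 0"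
    by (intro integral_cos_full_period trig_family_freq[OF fam])
  have args: "((real j + c) * x + \<theta>) - ((real k + c) * x + \<theta>) = ?m * x"
    "((real j + c) * x + \<theta>) + ((real k + c) * x + \<theta>) = ?p * x + 2 * \<theta>" for x
    by (simp_all add: algebra_simps)
  have ints: "(\<lambda>x. cos (?m * x) / 2) integrable_on {-pi..pi}" "(\<lambda>x. cos (?p * x + 2 * \<theta>) / 2) integrable_on {-pi..pi}"
    by (intro integrable_continuous_real continuous_intros; simp)+
  show "integral {-pi..pi} (\<lambda>x. cos ((real j + c) * x + \<theta>) * cos ((real k + c) * x + \<theta>)) = (if j = k then pi else 0)"
    unfolding cos_times_cos args add_divide_distrib
    using ints m p by (subst integral_add) auto
  show "integral {-pi..pi} (\<lambda>x. sin ((real j + c) * x + \<theta>) * sin ((real k + c) * x + \<theta>)) = (if j = k then pi else 0)"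
    unfolding sin_times_sin args diff_divide_distrib
    using ints m p by (subst integral_diff) auto
qed

text \<open>A mode of one family is odd and a mode of the other is even.\<close>

lemma trig_families_cross_orthogonal:
  "integral {-pi..pi} (\<lambda>x. sin ((real j + 1) * x + 0) * sin ((real k + 1/2) * x + pi / 2)) = 0"
  "integral {-pi..pi} (\<lambda>x. sin ((real j + 1/2) * x + pi / 2) * sin ((real k + 1) * x + 0)) = 0"
  by (intro integral_odd_eq_0; simp only: sin_add_half_pi; simp)+

text \<open>The cosine is the derivative of the mode up to a factor: three integrations by parts
  turn it back into the mode itself. With \<open>\<theta> = pi / 2\<close> it is a negative
  sine.\<close>

definition mode_coef :: "real \<Rightarrow> real \<Rightarrow> (real \<Rightarrow> real) \<Rightarrow> nat \<Rightarrow> real" where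
  "mode_coef c \<theta> g k = (1/pi) * integral {-pi..pi} (\<lambda>x. g x * cos ((real k + c) * x + \<theta>))"

lemma coef1_eq: "coef1 g (real (Suc k)) = mode_coef 1 0 g k"
  by (simp add: coef1_def mode_coef_def add.commute)

text \<open>This sign accounts for the minus in front of the second series of \<open>u_sol\<close>
  and \<open>f_sol\<close>.\<close>

lemma coef2_eq: "coef2 g (real k) = - mode_coef (1/2) (pi/2) g k"
  unfolding coef2_def mode_coef_def cos_add_half_pi by simp

text \<open>By \<open>2 a b \<le> a^2 + b^2\<close> the series is dominated by the squares of the
  coefficients, summable by Bessel, plus the squares of \<open>1 / (k + c)\<close>.\<close>

lemma mode_coef_summable:
  assumes fam: "trig_family c \<theta>"
    and g: "g measurable_on {-pi..pi}" "(\<lambda>x. (g x)\<^sup>2) integrable_on {-pi..pi}"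
  shows "summable (\<lambda>k. \<bar>mode_coef c \<theta> g k\<bar> / (real k + c))"
proof -
  let ?d = "mode_coef c \<theta> g"
  have c: "c \<ge> 1/2" using fam by (auto simp: trig_family_def)
  have "summable (\<lambda>k. (integral {-pi..pi} (\<lambda>x. g x * cos ((real k + c) * x + \<theta>)))\<^sup>2)"
    by (rule Bessel_inequality[OF g]) (auto intro!: continuous_intros simp: trig_family_orthogonal[OF fam])
  then have s1: "summable (\<lambda>k. (?d k)\<^sup>2)"
    unfolding mode_coef_def power_mult_distrib by (rule summable_mult)
  have s2: "summable (\<lambda>k. 4 * (1 / (real (Suc k))\<^sup>2))"
    using inverse_power_summable[of 2, where 'a = real]
    by (intro summable_mult) (subst summable_Suc_iff, simp add: inverse_eq_divide)
  show ?thesis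
  proof (rule summable_comparison_test'[OF summable_add[OF s1 s2]])
    fix k
    have pos: "real k + c > 0" using c by simp
    \<comment> \<open>\<open>k + 1 \<le> 2 * (k + c)\<close> since \<open>c \<ge> 1/2\<close>;
      squaring produces the factor 4.\<close>
    have "1 / (real k + c) \<le> 2 / real (Suc k)"
      using c by (simp add: field_simps)
    then have "(1 / (real k + c))\<^sup>2 \<le> (2 / real (Suc k))\<^sup>2" using pos by (intro power_mono) auto
    then have le: "(1 / (real k + c))\<^sup>2 \<le> 4 * (1 / (real (Suc k))\<^sup>2)" by (simp add: power_divide)
    have "0 \<le> (\<bar>?d k\<bar> - 1 / (real k + c))\<^sup>2" by simp
    then have "2 * (\<bar>?d k\<bar> / (real k + c)) \<le> (?d k)\<^sup>2 + (1 / (real k + c))\<^sup>2"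
      by (simp add: power2_diff)
    moreover have "\<bar>?d k\<bar> / (real k + c) \<ge> 0" using pos by simp
    moreover have "norm (\<bar>?d k\<bar> / (real k + c)) = \<bar>?d k\<bar> / (real k + c)" using pos by simp
    ultimately show "norm (\<bar>?d k\<bar> / (real k + c)) \<le> (?d k)\<^sup>2 + 4 * (1 / (real (Suc k))\<^sup>2)"
      using le by linarith
  qed
qed

text \<open>In three integrations by parts the boundary terms vanish in turn because
  \<open>g2\<close>, the mode, and \<open>g\<close> are zero at the endpoints; hence no condition on
  \<open>g1\<close> there. The first integration uses the indefinite-integral version, as
  \<open>g3\<close> is merely square integrable.\<close>

lemma mode_coef_third_derivative:
  assumes fam: "trig_family c \<theta>"
    and g: "C2_L2_third g g1 g2 g3" "g (-pi) = 0" "g pi = 0" "g2 (-pi) = 0" "g2 pi = 0"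
  shows "pi * mode_coef c \<theta> g3 k = - ((real k + c) ^ 3 * integral {-pi..pi} (\<lambda>x. g x * sin ((real k + c) * x + \<theta>)))"
proof -
  define m where "m = real k + c"
  note vanish = trig_family_vanish[OF fam, of k, folded m_def]
  have g': "\<And>x. x \<in> {-pi..pi} \<Longrightarrow> (g has_real_derivative g1 x) (at x within {-pi..pi})"
    "\<And>x. x \<in> {-pi..pi} \<Longrightarrow> (g1 has_real_derivative g2 x) (at x within {-pi..pi})"
    "continuous_on {-pi..pi} g2" "\<And>x. x \<in> {-pi..pi} \<Longrightarrow> g2 x = g2 (-pi) + integral {-pi..x} g3"
    and g3: "g3 measurable_on {-pi..pi}" "(\<lambda>x. (g3 x)\<^sup>2) integrable_on {-pi..pi}"
    using g(1) unfolding C2_L2_third_def by blast+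
  have g1_cont: "continuous_on {-pi..pi} g1"
    using g'(2) by (intro DERIV_continuous_on)
  have ds: "((\<lambda>x. sin (m * x + \<theta>)) has_real_derivative m * cos (m * x + \<theta>)) (at x)" for x
    by (auto intro!: derivative_eq_intros)
  have dc: "((\<lambda>x. cos (m * x + \<theta>)) has_real_derivative - m * sin (m * x + \<theta>)) (at x)" for x
    by (auto intro!: derivative_eq_intros)
  have conts: "continuous_on UNIV (\<lambda>x. m * cos (m * x + \<theta>))" "continuous_on UNIV (\<lambda>x. - m * sin (m * x + \<theta>))"
    by (intro continuous_intros)+
  have 1: "integral {-pi..pi} (\<lambda>x. g3 x * cos (m * x + \<theta>)) = m * integral {-pi..pi} (\<lambda>x. g2 x * sin (m * x + \<theta>))"
    using integral_by_parts_indefinite[OF _ square_integrable_imp_absolutely_integrable[OF g3] g'(4) dc conts(2)] g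
    by (simp add: mult.left_commute)
  have 2: "integral {-pi..pi} (\<lambda>x. g2 x * sin (m * x + \<theta>)) = - m * integral {-pi..pi} (\<lambda>x. g1 x * cos (m * x + \<theta>))"
    using integral_by_parts_smooth[OF _ g'(2) g'(3) ds conts(1)] vanish
    by (simp add: mult.left_commute)
  have 3: "integral {-pi..pi} (\<lambda>x. g1 x * cos (m * x + \<theta>)) = m * integral {-pi..pi} (\<lambda>x. g x * sin (m * x + \<theta>))"
    using integral_by_parts_smooth[OF _ g'(1) g1_cont dc conts(2)] g
    by (simp add: mult.left_commute)
  show ?thesis unfolding mode_coef_def m_def[symmetric] using 1 2 3 by (simp add: power3_eq_cube)
qed

section \<open>Termwise differentiation of the mode series\<close>

lemma continuous_on_suminf:
  fixes f :: "nat \<Rightarrow> 'a::topological_space \<Rightarrow> real"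
  assumes "\<And>k. continuous_on S (f k)" and "\<And>k z. z \<in> S \<Longrightarrow> \<bar>f k z\<bar> \<le> M k" and "summable M"
  shows "continuous_on S (\<lambda>z. \<Sum>k. f k z)"
proof (rule uniform_limit_theorem)
  show "uniform_limit S (\<lambda>n z. \<Sum>k<n. f k z) (\<lambda>z. \<Sum>k. f k z) sequentially"
    by (rule Weierstrass_m_test) (use assms in auto)
qed (auto intro!: always_eventually continuous_on_sum assms(1))

lemma has_real_derivative_suminf:
  fixes f :: "nat \<Rightarrow> real \<Rightarrow> real"
  assumes S: "convex S" "open S" "x \<in> S"
    and f': "\<And>k y. y \<in> S \<Longrightarrow> (f k has_real_derivative f' k y) (at y)"
    and bound: "\<And>k y. y \<in> S \<Longrightarrow> \<bar>f' k y\<bar> \<le> M k" and M: "summable M"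
    and "summable (\<lambda>k. f k x)"
  shows "((\<lambda>y. \<Sum>k. f k y) has_real_derivative (\<Sum>k. f' k x)) (at x)"
proof (rule has_field_derivative_series'(2)[OF S(1) _ _ S(3)])
  show "uniformly_convergent_on S (\<lambda>n y. \<Sum>i<n. f' i y)"
    by (rule Weierstrass_m_test') (use assms in auto)
qed (use assms in \<open>auto simp: interior_open intro: has_field_derivative_at_within\<close>)

text \<open>On functions of one parity the reflection acts as a sign, so the equation becomes an
  ordinary heat equation with diffusivity \<open>\<alpha>\<close>. The locale treats it once, for
  \<open>\<alpha> = 1 + \<epsilon>\<close> with the sines and
  \<open>\<alpha> = 1 - \<epsilon>\<close> with the cosines.\<close>

locale mode_series =
  fixes \<alpha> T c \<theta> :: real and d :: "nat \<Rightarrow> real"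
  assumes \<alpha>: "\<alpha> > 0" and T: "T > 0" and fam: "trig_family c \<theta>"
    and d: "summable (\<lambda>k. \<bar>d k\<bar> / (real k + c))"
begin

definition freq :: "nat \<Rightarrow> real" where "freq k = real k + c"

definition den :: "nat \<Rightarrow> real" where "den k = 1 - exp (- \<alpha> * (freq k)\<^sup>2 * T)"

text \<open>With \<open>\<mu> = \<alpha> (freq k)^2\<close> this is the solution of
  \<open>A' + \<mu> A = \<mu> / den k\<close> with \<open>A 0 = 0\<close> and
  \<open>A T = 1\<close>; the constant right side is the one forced by these two values.\<close>

definition amp :: "nat \<Rightarrow> real \<Rightarrow> real" where
  "amp k t = (1 - exp (- \<alpha> * (freq k)\<^sup>2 * t)) / den k"

definition U :: "nat \<Rightarrow> real \<Rightarrow> real \<Rightarrow> real" where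
  "U k x t = amp k t * (d k / freq k ^ 3) * sin (freq k * x + \<theta>)"

definition Ux :: "nat \<Rightarrow> real \<Rightarrow> real \<Rightarrow> real" where
  "Ux k x t = amp k t * (d k / (freq k)\<^sup>2) * cos (freq k * x + \<theta>)"

definition Uxx :: "nat \<Rightarrow> real \<Rightarrow> real \<Rightarrow> real" where
  "Uxx k x t = - (amp k t * (d k / freq k) * sin (freq k * x + \<theta>))"

definition Ut :: "nat \<Rightarrow> real \<Rightarrow> real \<Rightarrow> real" where
  "Ut k x t = \<alpha> * exp (- \<alpha> * (freq k)\<^sup>2 * t) / den k * (d k / freq k) * sin (freq k * x + \<theta>)"

definition F :: "nat \<Rightarrow> real \<Rightarrow> real" where
  "F k x = \<alpha> / den k * (d k / freq k) * sin (freq k * x + \<theta>)"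

definition u :: "real \<Rightarrow> real \<Rightarrow> real" where "u x t = (\<Sum>k. U k x t)"
definition ux :: "real \<Rightarrow> real \<Rightarrow> real" where "ux x t = (\<Sum>k. Ux k x t)"
definition uxx :: "real \<Rightarrow> real \<Rightarrow> real" where "uxx x t = (\<Sum>k. Uxx k x t)"
definition ut :: "real \<Rightarrow> real \<Rightarrow> real" where "ut x t = (\<Sum>k. Ut k x t)"
definition f :: "real \<Rightarrow> real" where "f x = (\<Sum>k. F k x)"

lemma freq_ge: "freq k \<ge> 1/2" and freq_pos: "freq k > 0"
  using fam by (auto simp: trig_family_def freq_def)

text \<open>The value of \<open>den\<close> at frequency 1/2, the lowest in either family; it bounds
  all denominators away from zero.\<close>

definition \<kappa> :: real where "\<kappa> = 1 - exp (- \<alpha> * (1/2)\<^sup>2 * T)"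

lemma \<kappa>_pos: "\<kappa> > 0"
  using \<alpha> T by (simp add: \<kappa>_def)

lemma den_ge: "den k \<ge> \<kappa>"
proof -
  have "(1/2)\<^sup>2 \<le> (freq k)\<^sup>2" using freq_ge[of k] by (intro power_mono) auto
  then have "\<alpha> * (1/2)\<^sup>2 * T \<le> \<alpha> * (freq k)\<^sup>2 * T"
    using \<alpha> T by (intro mult_right_mono mult_left_mono) auto
  then show ?thesis by (simp add: den_def \<kappa>_def)
qed

lemma den_pos: "den k > 0"
  using den_ge[of k] \<kappa>_pos by simp

text \<open>One majorant for all five series: 4 covers the factors \<open>1 / (freq k)^2\<close>,
  \<open>1 / freq k\<close> and 1 of \<open>U\<close>, \<open>Ux\<close> and \<open>Uxx\<close>, and
  \<open>\<alpha>\<close> covers those of \<open>Ut\<close> and \<open>F\<close>.\<close>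

definition bound :: "nat \<Rightarrow> real" where "bound k = (4 + \<alpha>) / \<kappa> * (\<bar>d k\<bar> / freq k)"

lemma bound_summable: "summable bound"
  unfolding bound_def freq_def by (intro summable_mult d)

lemma exp_decay: "t \<ge> 0 \<Longrightarrow> exp (- \<alpha> * (freq k)\<^sup>2 * t) \<le> 1"
  using \<alpha> by simp

text \<open>Here \<open>A\<close> is the time factor (\<open>1 - exp\<close>, \<open>exp\<close> or
  1), \<open>b\<close> is what is left of a coefficient once \<open>d k / freq k\<close> is split
  off, and \<open>w\<close> is the trigonometric factor.\<close>

lemma term_bound:
  assumes "0 \<le> A" "A \<le> 1" "\<bar>w\<bar> \<le> 1" "0 \<le> b" "b \<le> 4 + \<alpha>"
  shows "\<bar>A * b / den k * (d k / freq k) * w\<bar> \<le> bound k"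
proof -
  have "A * b \<le> 1 * (4 + \<alpha>)" using assms \<alpha> by (intro mult_mono) auto
  then have "A * b / den k \<le> (4 + \<alpha>) / \<kappa>"
    using assms \<alpha> \<kappa>_pos den_ge[of k] by (intro frac_le) auto
  then have "A * b / den k * (\<bar>d k\<bar> / freq k) * \<bar>w\<bar> \<le> (4 + \<alpha>) / \<kappa> * (\<bar>d k\<bar> / freq k) * 1"
    using assms \<alpha> \<kappa>_pos freq_pos[of k] den_pos[of k] by (intro mult_mono) (auto intro!: divide_nonneg_nonneg mult_nonneg_nonneg)
  then show ?thesis
    using assms freq_pos[of k] den_pos[of k] by (simp add: bound_def abs_mult)
qed

lemma inverse_freq: "1 / freq k \<le> 2" "1 / (freq k)\<^sup>2 \<le> 4"
proof -
  show *: "1 / freq k \<le> 2" using freq_ge[of k] by (simp add: field_simps)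
  have "(1 / freq k)\<^sup>2 \<le> 2\<^sup>2" using * freq_pos[of k] by (intro power_mono) auto
  then show "1 / (freq k)\<^sup>2 \<le> 4" by (simp add: power_divide)
qed

lemma U_bound: "t \<ge> 0 \<Longrightarrow> \<bar>U k x t\<bar> \<le> bound k"
  and Ux_bound: "t \<ge> 0 \<Longrightarrow> \<bar>Ux k x t\<bar> \<le> bound k"
  and Uxx_bound: "t \<ge> 0 \<Longrightarrow> \<bar>Uxx k x t\<bar> \<le> bound k"
  and Ut_bound: "t \<ge> 0 \<Longrightarrow> \<bar>Ut k x t\<bar> \<le> bound k"
  and F_bound: "\<bar>F k x\<bar> \<le> bound k"
proof -
  assume t: "t \<ge> 0"
  let ?A = "1 - exp (- \<alpha> * (freq k)\<^sup>2 * t)" and ?w = "sin (freq k * x + \<theta>)"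
  have A: "0 \<le> ?A" "?A \<le> 1" using exp_decay[OF t, of k] by auto
  have "U k x t = ?A * (1 / (freq k)\<^sup>2) / den k * (d k / freq k) * ?w"
    by (simp add: U_def amp_def power3_eq_cube power2_eq_square)
  then show "\<bar>U k x t\<bar> \<le> bound k"
    using term_bound[OF A, of ?w "1 / (freq k)\<^sup>2" k] inverse_freq[of k] \<alpha> by simp
  have "Ux k x t = ?A * (1 / freq k) / den k * (d k / freq k) * cos (freq k * x + \<theta>)"
    by (simp add: Ux_def amp_def power2_eq_square)
  then show "\<bar>Ux k x t\<bar> \<le> bound k"
    using term_bound[OF A, of "cos (freq k * x + \<theta>)" "1 / freq k" k] inverse_freq[of k] freq_pos[of k] \<alpha> by simp
  have "Uxx k x t = - (?A * 1 / den k * (d k / freq k) * ?w)"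
    by (simp add: Uxx_def amp_def)
  then show "\<bar>Uxx k x t\<bar> \<le> bound k"
    using term_bound[OF A, of ?w 1 k] \<alpha> by simp
  show "\<bar>Ut k x t\<bar> \<le> bound k"
    using term_bound[OF _ exp_decay[OF t, of k], of ?w \<alpha> k] \<alpha> by (simp add: Ut_def mult.commute)
next
  show "\<bar>F k x\<bar> \<le> bound k"
    using term_bound[of 1 "sin (freq k * x + \<theta>)" \<alpha> k] \<alpha> by (simp add: F_def)
qed

lemma summables:
  "t \<ge> 0 \<Longrightarrow> summable (\<lambda>k. U k x t)" "t \<ge> 0 \<Longrightarrow> summable (\<lambda>k. Ux k x t)"
  "t \<ge> 0 \<Longrightarrow> summable (\<lambda>k. Uxx k x t)" "t \<ge> 0 \<Longrightarrow> summable (\<lambda>k. Ut k x t)"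
  "summable (\<lambda>k. F k x)"
  by (rule summable_comparison_test'[OF bound_summable, of 0];
      use U_bound Ux_bound Uxx_bound Ut_bound F_bound in auto)+

lemma continuous_sums:
  "continuous_on (UNIV \<times> {0..}) (\<lambda>(x, t). u x t)"
  "continuous_on (UNIV \<times> {0..}) (\<lambda>(x, t). ux x t)"
  "continuous_on (UNIV \<times> {0..}) (\<lambda>(x, t). uxx x t)"
  "continuous_on (UNIV \<times> {0..}) (\<lambda>(x, t). ut x t)"
  "continuous_on UNIV f"
  unfolding u_def ux_def uxx_def ut_def f_def case_prod_beta
  by (rule continuous_on_suminf[OF _ _ bound_summable];
      use U_bound Ux_bound Uxx_bound Ut_bound F_bound den_pos freq_pos in
        \<open>auto simp: U_def Ux_def Uxx_def Ut_def F_def amp_def less_imp_neq[THEN not_sym] intro!: continuous_intros\<close>)+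

lemma sin_deriv: "((\<lambda>x. sin (freq k * x + \<theta>)) has_real_derivative freq k * cos (freq k * x + \<theta>)) (at x)"
  and cos_deriv: "((\<lambda>x. cos (freq k * x + \<theta>)) has_real_derivative - (freq k * sin (freq k * x + \<theta>))) (at x)"
  by (auto intro!: derivative_eq_intros)

lemma u_deriv_x: "t \<ge> 0 \<Longrightarrow> ((\<lambda>y. u y t) has_real_derivative ux x t) (at x)"
  unfolding u_def ux_def
proof (rule has_real_derivative_suminf[of UNIV])
  show "((\<lambda>x. U k x t) has_real_derivative Ux k y t) (at y)" for k y
    unfolding U_def by (rule DERIV_cong[OF DERIV_cmult[OF sin_deriv]])
      (use freq_pos[of k] in \<open>simp add: Ux_def power2_eq_square power3_eq_cube\<close>)
qed (auto intro: Ux_bound bound_summable summables)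

lemma ux_deriv_x: "t \<ge> 0 \<Longrightarrow> ((\<lambda>y. ux y t) has_real_derivative uxx x t) (at x)"
  unfolding uxx_def ux_def
proof (rule has_real_derivative_suminf[of UNIV])
  show "((\<lambda>x. Ux k x t) has_real_derivative Uxx k y t) (at y)" for k y
    unfolding Ux_def by (rule DERIV_cong[OF DERIV_cmult[OF cos_deriv]])
      (use freq_pos[of k] in \<open>simp add: Uxx_def power2_eq_square\<close>)
qed (auto intro: Uxx_bound bound_summable summables)

text \<open>Termwise differentiation needs an open set of times, and the majorant holds only for
  nonnegative ones, where the exponentials do not exceed 1.\<close>

lemma u_deriv_t: "t > 0 \<Longrightarrow> ((\<lambda>s. u x s) has_real_derivative ut x t) (at t)"
  unfolding u_def ut_def
proof (rule has_real_derivative_suminf[of "{0<..}"])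
  show "((\<lambda>t. U k x t) has_real_derivative Ut k x s) (at s)" for k s
    unfolding U_def amp_def
    by (rule derivative_eq_intros refl | use den_pos[of k] freq_pos[of k] in \<open>simp add: Ut_def field_simps power2_eq_square power3_eq_cube\<close>)+
qed (auto intro: Ut_bound bound_summable summables)

text \<open>In each term the decaying exponential of \<open>Ut\<close> cancels the one in
  \<open>amp\<close>, so that a source independent of time remains.\<close>

lemma heat_equation: "t \<ge> 0 \<Longrightarrow> ut x t - \<alpha> * uxx x t = f x"
proof -
  assume t: "t \<ge> 0"
  have "Ut k x t - \<alpha> * Uxx k x t = F k x" for k
    by (simp add: Ut_def Uxx_def F_def amp_def algebra_simps add_divide_distrib diff_divide_distrib)
  then show ?thesis
    unfolding ut_def uxx_def f_def
    using summables(3)[OF t, of x] summables(4)[OF t, of x]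
    by (simp add: suminf_mult[symmetric] suminf_diff summable_mult)
qed

lemma u_boundary: "u pi t = 0" "u (- pi) t = 0"
  using trig_family_vanish[OF fam] by (simp_all add: u_def U_def freq_def)

lemma u_initial: "u x 0 = 0"
  by (simp add: u_def U_def amp_def)

lemma amp_final: "amp k T = 1"
  unfolding amp_def den_def[symmetric] using den_pos[of k] by simp

lemma uxx_reflect:
  assumes "\<And>y. sin (- y + \<theta>) = \<sigma> * sin (y + \<theta>)"
  shows "t \<ge> 0 \<Longrightarrow> uxx (- x) t = \<sigma> * uxx x t"
proof -
  assume t: "t \<ge> 0"
  have "Uxx k (- x) t = \<sigma> * Uxx k x t" for k
    using assms[of "freq k * x"] by (simp add: Uxx_def)
  then show ?thesis unfolding uxx_def using summables(3)[OF t] by (simp add: suminf_mult)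
qed

text \<open>The majorant makes the series converge uniformly in \<open>x\<close>, also after
  multiplication by the bounded \<open>h\<close>, so it may be integrated term by term.\<close>

lemma u_integral_sums:
  assumes t: "t \<ge> 0" and h: "continuous_on {-pi..pi} h"
  shows "(\<lambda>k. amp k t * (d k / freq k ^ 3) * integral {-pi..pi} (\<lambda>x. sin (freq k * x + \<theta>) * h x))
    sums integral {-pi..pi} (\<lambda>x. u x t * h x)"
proof -
  have U_cont: "continuous_on {-pi..pi} (\<lambda>x. U k x t)" for k
    unfolding U_def by (intro continuous_intros)
  have "bounded (h ` {-pi..pi})" by (intro compact_imp_bounded compact_continuous_image h) auto
  then obtain B where B: "\<And>x. x \<in> {-pi..pi} \<Longrightarrow> \<bar>h x\<bar> \<le> B"
    by (metis bounded_iff imageI real_norm_def)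
  have lim: "uniform_limit {-pi..pi} (\<lambda>n x. \<Sum>k<n. U k x t * h x) (\<lambda>x. \<Sum>k. U k x t * h x) sequentially"
  proof (rule Weierstrass_m_test)
    show "summable (\<lambda>k. bound k * B)" by (intro summable_mult2 bound_summable)
    fix k x assume "x \<in> {-pi..pi}"
    then show "norm (U k x t * h x) \<le> bound k * B"
      unfolding real_norm_def abs_mult
      using U_bound[OF t, of k x] B[of x] by (intro mult_mono) auto
  qed
  obtain I J where IJ: "\<And>n. ((\<lambda>x. \<Sum>k<n. U k x t * h x) has_integral I n) {-pi..pi}"
    "((\<lambda>x. \<Sum>k. U k x t * h x) has_integral J) {-pi..pi}" "I \<longlonglongrightarrow> J"
    by (rule uniform_limit_integral[OF lim]) (auto intro!: continuous_intros U_cont h)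
  have "I = (\<lambda>n. \<Sum>k<n. amp k t * (d k / freq k ^ 3) * integral {-pi..pi} (\<lambda>x. sin (freq k * x + \<theta>) * h x))"
  proof
    fix n
    have "I n = integral {-pi..pi} (\<lambda>x. \<Sum>k<n. amp k t * (d k / freq k ^ 3) * (sin (freq k * x + \<theta>) * h x))"
      using IJ(1)[of n] by (simp add: integral_unique U_def mult.assoc)
    also have "\<dots> = (\<Sum>k<n. amp k t * (d k / freq k ^ 3) * integral {-pi..pi} (\<lambda>x. sin (freq k * x + \<theta>) * h x))"
      by (subst integral_sum) (auto intro!: integrable_on_mult_right integrable_continuous_real continuous_intros h
          simp del: times_divide_eq_left times_divide_eq_right)
    finally show "I n = (\<Sum>k<n. amp k t * (d k / freq k ^ 3) * integral {-pi..pi} (\<lambda>x. sin (freq k * x + \<theta>) * h x))" .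
  qed
  moreover have "J = integral {-pi..pi} (\<lambda>x. u x t * h x)"
  proof -
    have "(\<Sum>k. U k x t * h x) = u x t * h x" for x
      unfolding u_def by (rule suminf_mult2[OF summables(1)[OF t], symmetric])
    with IJ(2) show ?thesis by (simp add: integral_unique)
  qed
  ultimately show ?thesis using IJ(3) unfolding sums_def by (simp only:)
qed

text \<open>Orthogonality leaves one term, and its amplitude at time \<open>T\<close> is 1 by the
  normalization of \<open>amp\<close>.\<close>

lemma u_integral_final:
  "integral {-pi..pi} (\<lambda>x. u x T * sin (freq j * x + \<theta>)) = pi * (d j / freq j ^ 3)"
proof -
  have "(\<lambda>k. if k = j then pi * (d k / freq k ^ 3) else 0)
      sums integral {-pi..pi} (\<lambda>x. u x T * sin (freq j * x + \<theta>))"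
  proof (rule sums_cong[THEN iffD1])
    show "(\<lambda>k. amp k T * (d k / freq k ^ 3) * integral {-pi..pi} (\<lambda>x. sin (freq k * x + \<theta>) * sin (freq j * x + \<theta>)))
      sums integral {-pi..pi} (\<lambda>x. u x T * sin (freq j * x + \<theta>))"
      using T by (intro u_integral_sums continuous_intros) simp
  qed (simp add: amp_final freq_def trig_family_orthogonal[OF fam])
  then show ?thesis by (rule sums_unique2[OF _ sums_single])
qed

lemma u_integral_orthogonal:
  assumes "t \<ge> 0" "continuous_on {-pi..pi} h"
    and "\<And>k. integral {-pi..pi} (\<lambda>x. sin (freq k * x + \<theta>) * h x) = 0"
  shows "integral {-pi..pi} (\<lambda>x. u x t * h x) = 0"
  using u_integral_sums[OF assms(1,2)] unfolding assms(3) mult_zero_right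
  by (rule sums_unique2[OF _ sums_zero])

end

section \<open>The Fourier coefficients of a regular solution\<close>

text \<open>\<open>exp (\<mu> t) (D t - b / \<mu>)\<close> is constant. Comparing its values at 0
  and \<open>T\<close> determines the unknown source \<open>b\<close>, and then \<open>D\<close>:
  this is the scalar inverse problem.\<close>

lemma linear_ode_two_point:
  fixes D :: "real \<Rightarrow> real"
  assumes T: "T > 0" and \<mu>: "\<mu> > 0"
    and cont: "continuous_on {0..T} D"
    and ode: "\<And>t. t \<in> {0<..<T} \<Longrightarrow> (D has_real_derivative (b - \<mu> * D t)) (at t)"
    and ends: "D 0 = 0" "D T = 0"
  shows "b = 0" and "t \<in> {0..T} \<Longrightarrow> D t = 0"
proof -
  define E where "E t = exp (\<mu> * t) * (D t - b / \<mu>)" for t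
  have E_cont: "continuous_on {0..T} E"
    unfolding E_def by (intro continuous_intros cont) (use \<mu> in auto)
  have E_deriv: "(E has_real_derivative 0) (at t)" if "0 < t" "t < T" for t
    unfolding E_def using \<mu> that
    by (auto intro!: derivative_eq_intros ode simp: field_simps)
  have const: "E t = E 0" if "t \<in> {0..T}" for t
    by (rule DERIV_isconst2[OF T E_cont]) (use E_deriv that in auto)
  from const[of T] T ends have "(exp (\<mu> * T) - 1) * (b / \<mu>) = 0"
    by (simp add: E_def algebra_simps)
  moreover have "exp (\<mu> * T) \<noteq> 1" using T \<mu> by simp
  ultimately show b: "b = 0" using \<mu> by simp
  show "t \<in> {0..T} \<Longrightarrow> D t = 0" using const[of t] ends b by (simp add: E_def)
qed

text \<open>A regular solution is only \<open>C\<^sup>2\<close> in the open rectangle, so one cannot integrate by parts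
  directly up to the boundary. We integrate the dilations \<open>u(\<rho>y, t)\<close> with \<open>\<rho> < 1\<close> instead, and let
  \<open>\<rho> \<rightarrow> 1\<close> uniformly in \<open>t\<close>.\<close>

lemma regular_solution_coefficient_ode:
  assumes sol: "regular_solution T \<epsilon> \<phi> \<psi> u f" and T: "T > 0"
    and vanish: "sin (m * pi + \<theta>) = 0" "sin (m * (- pi) + \<theta>) = 0"
    and parity: "\<And>y. sin (- y + \<theta>) = \<sigma> * sin (y + \<theta>)"
  defines "G \<equiv> (\<lambda>t. integral {-pi..pi} (\<lambda>y. u y t * sin (m * y + \<theta>)))"
  shows "continuous_on {0..T} G"
    and "t \<in> {0<..<T} \<Longrightarrow> (G has_real_derivative
      (integral {-pi..pi} (\<lambda>y. f y * sin (m * y + \<theta>)) - (1 - \<sigma> * \<epsilon>) * m\<^sup>2 * G t)) (at t)"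
proof -
  let ?e = "\<lambda>y. sin (m * y + \<theta>)"
  have C: "C21 u (Omega T)" and u_cont: "continuous_on ({-pi..pi} \<times> {0..T}) (\<lambda>(x, t). u x t)"
    and f_cont: "continuous_on {-pi..pi} f"
    and eq: "\<And>x t. (x, t) \<in> Omega T \<Longrightarrow> pdt u x t - pdxx u x t + \<epsilon> * pdxx u (- x) t = f x"
    and lateral: "\<And>t. t \<in> {0..T} \<Longrightarrow> u (- pi) t = 0" "\<And>t. t \<in> {0..T} \<Longrightarrow> u pi t = 0"
    using sol unfolding regular_solution_def by blast+
  have d1: "((\<lambda>y. u y t) has_real_derivative pdx u x t) (at x)"
    and d2: "((\<lambda>y. pdx u y t) has_real_derivative pdxx u x t) (at x)"
    and d3: "((\<lambda>s. u x s) has_real_derivative pdt u x t) (at t)" if "(x, t) \<in> Omega T" for x t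
    using C that unfolding C21_def pdx_def[of u x t] pdxx_def[of u x t] pdt_def[of u x t] DERIV_deriv_iff_real_differentiable
    by blast+
  have c1: "continuous_on (Omega T) (\<lambda>(x, t). pdx u x t)" and c2: "continuous_on (Omega T) (\<lambda>(x, t). pdxx u x t)"
    and c3: "continuous_on (Omega T) (\<lambda>(x, t). pdt u x t)"
    using C unfolding C21_def by blast+
  have scale: "\<rho> * y \<in> {-pi..pi}" "- (\<rho> * y) \<in> {-pi..pi}" if "\<rho> \<in> {0..1}" "y \<in> {-pi..pi}" for \<rho> y :: real
  proof -
    have "\<bar>\<rho> * y\<bar> \<le> 1 * pi" unfolding abs_mult using that by (intro mult_mono) auto
    then show "\<rho> * y \<in> {-pi..pi}" "- (\<rho> * y) \<in> {-pi..pi}" by auto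
  qed
  have scale_strict: "\<rho> * y \<in> {-pi<..<pi}" "- (\<rho> * y) \<in> {-pi<..<pi}"
    if "\<rho> \<in> {0<..<1}" "y \<in> {-pi..pi}" for \<rho> y :: real
  proof -
    have "\<bar>\<rho> * y\<bar> \<le> \<rho> * pi" unfolding abs_mult using that by (intro mult_mono) auto
    also have "\<dots> < pi" using that by simp
    finally show "\<rho> * y \<in> {-pi<..<pi}" "- (\<rho> * y) \<in> {-pi<..<pi}" by auto
  qed

  \<comment> \<open>Dilation commutes with the reflection, so the equation at
    \<open>\<rho> * y\<close> stays within the dilated functions. The weight is left undilated: it
    still vanishes at the endpoints, which removes the boundary terms in \<open>pdx u\<close>, about
    which nothing is known near the lateral sides.\<close>
  define W where "W \<rho> t = integral {-pi..pi} (\<lambda>y. u (\<rho> * y) t * ?e y)" for \<rho> t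
  have W_cont: "continuous_on ({0..1} \<times> {0..T}) (\<lambda>p. W (fst p) (snd p))"
  proof -
    have "continuous_on (({0..1} \<times> {0..T}) \<times> {-pi..pi}) (\<lambda>z. (\<lambda>(x, t). u x t) (fst (fst z) * snd z, snd (fst z)))"
      by (rule continuous_on_compose2[OF u_cont]) (auto intro!: continuous_intros scale simp: scale simp del: atLeastAtMost_iff)
    then have "continuous_on (({0..1} \<times> {0..T}) \<times> cbox (-pi) pi) (\<lambda>(p, y). u (fst p * y) (snd p) * ?e y)"
      unfolding case_prod_beta by (auto intro!: continuous_intros)
    then show ?thesis
      using integral_continuous_on_param[of "{0..1} \<times> {0..T}" "-pi" pi "\<lambda>p y. u (fst p * y) (snd p) * ?e y"]
      by (simp add: W_def)
  qed
  define P where "P \<rho> = integral {-pi..pi} (\<lambda>y. f (\<rho> * y) * ?e y)" for \<rho>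
  have P_cont: "continuous_on {0..1} P"
  proof -
    have "continuous_on ({0..1} \<times> {-pi..pi}) (\<lambda>z. f (fst z * snd z))"
      by (rule continuous_on_compose2[OF f_cont]) (auto intro!: continuous_intros scale simp: scale simp del: atLeastAtMost_iff)
    then have "continuous_on ({0..1} \<times> cbox (-pi) pi) (\<lambda>(\<rho>, y). f (\<rho> * y) * ?e y)"
      unfolding case_prod_beta by (auto intro!: continuous_intros)
    then show ?thesis
      unfolding P_def using integral_continuous_on_param[of "{0..1}" "-pi" pi "\<lambda>\<rho> y. f (\<rho> * y) * ?e y"] by simp
  qed
  \<comment> \<open>The dilated integral of \<open>pdxx u\<close> after two integrations by parts;
    \<open>1 / \<rho>\<^sup>2\<close> comes from the chain rule. Only values of \<open>u\<close>
    occur, so \<open>X\<close> makes sense and is continuous at \<open>\<rho> = 1\<close> as well,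
    where the integral of \<open>pdxx u\<close> need not exist.\<close>
  define X where "X \<rho> t = - (m / \<rho>\<^sup>2) * (u (\<rho> * pi) t * cos (m * pi + \<theta>)
      - u (\<rho> * (- pi)) t * cos (m * (- pi) + \<theta>) + m * W \<rho> t)" for \<rho> t
  define R where "R \<rho> t = (1 - \<sigma> * \<epsilon>) * X \<rho> t + P \<rho>" for \<rho> t

  have pdxx_integral: "integral {-pi..pi} (\<lambda>y. pdxx u (\<rho> * y) t * ?e y) = X \<rho> t"
    and pdxx_cont: "continuous_on {-pi..pi} (\<lambda>y. pdxx u (\<rho> * y) t)"
    if \<rho>: "\<rho> \<in> {0<..<1}" and t: "t \<in> {0<..<T}" for \<rho> t
  proof -
    have in_Omega: "(\<rho> * y, t) \<in> Omega T" if "y \<in> {-pi..pi}" for y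
      using scale_strict(1)[OF \<rho> that] t by (simp add: Omega_def)
    have inner: "((\<lambda>y. \<rho> * y) has_real_derivative \<rho>) (at y within {-pi..pi})" for y
      by (auto intro!: derivative_eq_intros)
    have conts: "continuous_on {-pi..pi} (\<lambda>y. h (\<rho> * y) t)" if "continuous_on (Omega T) (\<lambda>(x, t). h x t)" for h
    proof -
      have "continuous_on {-pi..pi} (\<lambda>y. (\<lambda>(x, t). h x t) (\<rho> * y, t))"
        by (rule continuous_on_compose2[OF that]) (auto intro!: continuous_intros in_Omega)
      then show ?thesis by simp
    qed
    show pdxx_cont: "continuous_on {-pi..pi} (\<lambda>y. pdxx u (\<rho> * y) t)" by (rule conts[OF c2])
    have g2: "((\<lambda>y. pdx u (\<rho> * y) t / \<rho>) has_real_derivative pdxx u (\<rho> * y) t) (at y within {-pi..pi})"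
      if "y \<in> {-pi..pi}" for y
      using DERIV_cdivide[OF DERIV_chain2[OF d2[OF in_Omega[OF that]] inner], of \<rho>] \<rho> by simp
    have g1: "((\<lambda>y. u (\<rho> * y) t / \<rho>) has_real_derivative pdx u (\<rho> * y) t) (at y within {-pi..pi})"
      if "y \<in> {-pi..pi}" for y
      using DERIV_cdivide[OF DERIV_chain2[OF d1[OF in_Omega[OF that]] inner], of \<rho>] \<rho> by simp
    have ds: "((\<lambda>x. sin (m * x + \<theta>)) has_real_derivative m * cos (m * x + \<theta>)) (at x)" for x
      by (auto intro!: derivative_eq_intros)
    have dc: "((\<lambda>x. cos (m * x + \<theta>)) has_real_derivative - m * sin (m * x + \<theta>)) (at x)" for x
      by (auto intro!: derivative_eq_intros)
    have cont_cos: "continuous_on UNIV (\<lambda>x. m * cos (m * x + \<theta>))"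
      by (intro continuous_intros)
    have "integral {-pi..pi} (\<lambda>y. pdxx u (\<rho> * y) t * ?e y)
        = - integral {-pi..pi} (\<lambda>y. pdx u (\<rho> * y) t / \<rho> * (m * cos (m * y + \<theta>)))"
      using integral_by_parts_smooth[OF _ g2 pdxx_cont ds cont_cos] vanish by simp
    also have "\<dots> = - (m / \<rho>) * integral {-pi..pi} (\<lambda>y. pdx u (\<rho> * y) t * cos (m * y + \<theta>))"
      by (subst integral_mult_right[symmetric]) (simp add: mult_ac)
    also have "integral {-pi..pi} (\<lambda>y. pdx u (\<rho> * y) t * cos (m * y + \<theta>))
       = u (\<rho> * pi) t / \<rho> * cos (m * pi + \<theta>) - u (\<rho> * (- pi)) t / \<rho> * cos (m * (- pi) + \<theta>)
         - integral {-pi..pi} (\<lambda>y. u (\<rho> * y) t / \<rho> * (- m * sin (m * y + \<theta>)))"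
      by (rule integral_by_parts_smooth[OF _ g1 conts[OF c1] dc]) (auto intro!: continuous_intros)
    also have "integral {-pi..pi} (\<lambda>y. u (\<rho> * y) t / \<rho> * (- m * sin (m * y + \<theta>))) = - (m / \<rho>) * W \<rho> t"
      unfolding W_def by (subst integral_mult_right[symmetric]) (simp add: mult_ac)
    also have "- (m / \<rho>) * (u (\<rho> * pi) t / \<rho> * cos (m * pi + \<theta>)
        - u (\<rho> * (- pi)) t / \<rho> * cos (m * (- pi) + \<theta>) - - (m / \<rho>) * W \<rho> t) = X \<rho> t"
    proof -
      have "- (m * q) * (A * q * a - B * q * b - - (m * q) * w) = - (m * q\<^sup>2) * (A * a - B * b + m * w)"
        for q A B a b w
        by (simp add: power2_eq_square algebra_simps)
      from this[of "inverse \<rho>"] show ?thesis unfolding X_def by (simp only: divide_inverse power_inverse)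
    qed
    finally show "integral {-pi..pi} (\<lambda>y. pdxx u (\<rho> * y) t * ?e y) = X \<rho> t" .
  qed

  have W_deriv: "((\<lambda>s. W \<rho> s) has_real_derivative R \<rho> t) (at t within {0<..<T})"
    if \<rho>: "\<rho> \<in> {0<..<1}" and t: "t \<in> {0<..<T}" for \<rho> t
  proof -
    have in_Omega: "(\<rho> * y, s) \<in> Omega T" "(- (\<rho> * y), s) \<in> Omega T" if "y \<in> {-pi..pi}" "s \<in> {0<..<T}" for y s
      using scale_strict[OF \<rho> that(1)] that(2) by (simp_all add: Omega_def)
    have in_rectangle: "\<rho> * y \<in> {-pi..pi}" if "y \<in> {-pi..pi}" for y
      using scale(1)[OF _ that, of \<rho>] \<rho> by simp
    have "((\<lambda>s. integral (cbox (-pi) pi) (\<lambda>y. u (\<rho> * y) s * ?e y)) has_real_derivative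
        integral (cbox (-pi) pi) (\<lambda>y. pdt u (\<rho> * y) t * ?e y)) (at t within {0<..<T})"
    proof (rule leibniz_rule_field_derivative[OF _ _ _ t])
      fix s y assume s: "s \<in> {0<..<T}" and "y \<in> cbox (- pi) pi"
      then show "((\<lambda>s. u (\<rho> * y) s * ?e y) has_real_derivative pdt u (\<rho> * y) s * ?e y) (at s within {0<..<T})"
        by (intro DERIV_cmult_right[OF has_field_derivative_at_within[OF d3]] in_Omega) auto
    next
      fix s assume "s \<in> {0<..<T}"
      then have s: "s \<in> {0..T}" by simp
      have "continuous_on {-pi..pi} (\<lambda>y. (\<lambda>(x, t). u x t) (\<rho> * y, s))"
        by (rule continuous_on_compose2[OF u_cont])
          (use s in \<open>auto intro!: continuous_intros in_rectangle simp del: atLeastAtMost_iff\<close>)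
      then show "(\<lambda>y. u (\<rho> * y) s * ?e y) integrable_on cbox (-pi) pi"
        by (auto intro!: integrable_continuous_real continuous_intros)
    next
      have "continuous_on ({0<..<T} \<times> {-pi..pi}) (\<lambda>z. (\<lambda>(x, t). pdt u x t) (\<rho> * snd z, fst z))"
        by (rule continuous_on_compose2[OF c3]) (auto intro!: continuous_intros in_Omega)
      then show "continuous_on ({0<..<T} \<times> cbox (-pi) pi) (\<lambda>(s, y). pdt u (\<rho> * y) s * ?e y)"
        unfolding case_prod_beta by (auto intro!: continuous_intros)
    qed simp
    moreover have "integral {-pi..pi} (\<lambda>y. pdt u (\<rho> * y) t * ?e y) = R \<rho> t"
    proof -
      have int1: "(\<lambda>y. pdxx u (\<rho> * y) t * ?e y) integrable_on {-pi..pi}"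
        by (intro integrable_continuous_real continuous_intros pdxx_cont \<rho> t)
      have "continuous_on {-pi..pi} (\<lambda>y. pdxx u (\<rho> * (- y)) t)"
        by (rule continuous_on_compose2[OF pdxx_cont[OF \<rho> t]]) (auto intro!: continuous_intros)
      then have int2: "(\<lambda>y. pdxx u (\<rho> * (- y)) t * ?e y) integrable_on {-pi..pi}"
        by (intro integrable_continuous_real continuous_intros)
      have "continuous_on {-pi..pi} (\<lambda>y. f (\<rho> * y))"
        by (rule continuous_on_compose2[OF f_cont]) (auto intro!: continuous_intros in_rectangle simp del: atLeastAtMost_iff)
      then have int3: "(\<lambda>y. f (\<rho> * y) * ?e y) integrable_on {-pi..pi}"
        by (intro integrable_continuous_real continuous_intros)
      have "integral {-pi..pi} (\<lambda>y. pdt u (\<rho> * y) t * ?e y)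
        = integral {-pi..pi} (\<lambda>y. (pdxx u (\<rho> * y) t * ?e y - \<epsilon> * (pdxx u (\<rho> * (- y)) t * ?e y)) + f (\<rho> * y) * ?e y)"
      proof (rule integral_cong)
        fix y assume "y \<in> {-pi..pi}"
        then have "pdt u (\<rho> * y) t = pdxx u (\<rho> * y) t - \<epsilon> * pdxx u (\<rho> * (- y)) t + f (\<rho> * y)"
          using eq[OF in_Omega(1)[OF _ t], of y] by simp
        then show "pdt u (\<rho> * y) t * ?e y
          = (pdxx u (\<rho> * y) t * ?e y - \<epsilon> * (pdxx u (\<rho> * (- y)) t * ?e y)) + f (\<rho> * y) * ?e y"
          by (simp only:) (simp add: algebra_simps)
      qed
      also have "\<dots> = integral {-pi..pi} (\<lambda>y. pdxx u (\<rho> * y) t * ?e y)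
          - \<epsilon> * integral {-pi..pi} (\<lambda>y. pdxx u (\<rho> * (- y)) t * ?e y) + P \<rho>"
        unfolding P_def
        by (subst integral_add, intro integrable_diff integrable_on_mult_right int1 int2, rule int3,
            subst integral_diff) (use int1 int2 in \<open>auto intro!: integrable_on_mult_right\<close>)
      \<comment> \<open>Substituting \<open>- y\<close> for \<open>y\<close> moves the reflection
        from \<open>u\<close> onto the mode, which answers with the sign
        \<open>\<sigma>\<close>.\<close>
      also have "integral {-pi..pi} (\<lambda>y. pdxx u (\<rho> * (- y)) t * ?e y) = \<sigma> * X \<rho> t"
      proof -
        have "integral {-pi..pi} (\<lambda>y. pdxx u (\<rho> * (- y)) t * ?e y)
            = integral {-pi..pi} (\<lambda>y. pdxx u (\<rho> * y) t * ?e (- y))"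
          using integral_reflect_sym[of pi "\<lambda>y. pdxx u (\<rho> * y) t * ?e (- y)"] by simp
        also have "\<dots> = \<sigma> * integral {-pi..pi} (\<lambda>y. pdxx u (\<rho> * y) t * ?e y)"
          using parity[of "m * _"] by (subst integral_mult_right[symmetric]) (simp add: mult_ac)
        finally show ?thesis by (simp add: pdxx_integral[OF \<rho> t])
      qed
      finally show ?thesis 
        unfolding pdxx_integral[OF \<rho> t] R_def by (simp add: algebra_simps)
    qed
    ultimately show ?thesis by (simp add: W_def)
  qed

  \<comment> \<open>Staying above 1/2 avoids the pole of \<open>1 / \<rho>\<^sup>2\<close> at 0;
    compactness then yields convergence as \<open>\<rho>\<close> tends to 1 that is uniform in
    time.\<close>
  have R_cont: "continuous_on ({1/2..1} \<times> {0..T}) (\<lambda>p. R (fst p) (snd p))"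
  proof -
    have u_side: "continuous_on ({1/2..1} \<times> {0..T}) (\<lambda>p. u (fst p * y) (snd p))" if "y \<in> {-pi..pi}" for y
    proof -
      have "continuous_on ({1/2..1} \<times> {0..T}) (\<lambda>p. (\<lambda>(x, t). u x t) (fst p * y, snd p))"
        by (rule continuous_on_compose2[OF u_cont])
          (use scale[OF _ that] in \<open>auto intro!: continuous_intros\<close>)
      then show ?thesis by simp
    qed
    have W': "continuous_on ({1/2..1} \<times> {0..T}) (\<lambda>p. W (fst p) (snd p))"
      by (rule continuous_on_subset[OF W_cont]) auto
    have P': "continuous_on ({1/2..1} \<times> {0..T}) (\<lambda>p. P (fst p))"
      by (rule continuous_on_compose2[OF P_cont]) (auto intro!: continuous_intros)
    show ?thesis
      unfolding R_def X_def
      by (intro continuous_intros u_side W' P') auto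
  qed
  have G_eq: "G = W 1" by (auto simp: G_def W_def)
  show "continuous_on {0..T} G"
  proof -
    have "continuous_on {0..T} (\<lambda>t. (\<lambda>p. W (fst p) (snd p)) (1, t))"
      by (rule continuous_on_compose2[OF W_cont]) (auto intro!: continuous_intros)
    then show ?thesis by (simp add: G_eq)
  qed
  \<comment> \<open>The offset 2 puts every \<open>r n\<close> in \<open>[1/2, 1)\<close>.\<close>
  define r where "r n = 1 - 1 / (real n + 2)" for n
  have r: "r n \<in> {1/2..<1}" for n by (auto simp: r_def field_simps)
  have r_lim: "r \<longlonglongrightarrow> 1" 
  proof -
    have "(\<lambda>n. 1 - inverse (real (Suc (Suc n)))) \<longlonglongrightarrow> 1 - 0"
      by (intro tendsto_intros LIMSEQ_Suc[OF LIMSEQ_inverse_real_of_nat])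
    then show ?thesis by (simp add: r_def [abs_def] inverse_eq_divide add_ac)
  qed
  have W_lim: "(\<lambda>n. W (r n) s) \<longlonglongrightarrow> W 1 s" if "s \<in> {0<..<T}" for s
  proof -
    have "r n \<in> {0..1}" for n using r[of n] by auto
    moreover have "continuous_on {0..1} (\<lambda>\<rho>. (\<lambda>p. W (fst p) (snd p)) (\<rho>, s))"
      by (rule continuous_on_compose2[OF W_cont]) (use that in \<open>auto intro!: continuous_intros\<close>)
    then have "continuous_on {0..1} (\<lambda>\<rho>. W \<rho> s)" by simp
    ultimately show ?thesis
      by (intro continuous_on_tendsto_compose[OF _ r_lim, of "{0..1}" "\<lambda>\<rho>. W \<rho> s"]) auto
  qed
  assume t: "t \<in> {0<..<T}"
  \<comment> \<open>The derivatives \<open>R (r n)\<close> converge uniformly to \<open>R 1\<close>,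
    so the limit of \<open>W (r n)\<close>, which is \<open>G\<close>, is differentiable with
    derivative \<open>R 1\<close>.\<close>
  have "\<exists>g. \<forall>s\<in>{0<..<T}. (\<lambda>n. W (r n) s) \<longlonglongrightarrow> g s \<and> (g has_derivative (\<lambda>h. R 1 s * h)) (at s within {0<..<T})"
  proof (rule has_derivative_sequence[where f' = "\<lambda>n s h. R (r n) s * h"])
    fix n s assume "s \<in> {0<..<T}"
    then show "(W (r n) has_derivative (\<lambda>h. R (r n) s * h)) (at s within {0<..<T})"
      using W_deriv[of "r n" s] r[of n] by (simp add: has_field_derivative_def)
  next
    fix e :: real assume e: "e > 0"
    have "uniformly_continuous_on ({1/2..1} \<times> {0..T}) (\<lambda>p. R (fst p) (snd p))"
      by (intro compact_uniformly_continuous R_cont compact_Times) auto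
    then obtain \<delta> where \<delta>: "\<delta> > 0" "\<And>p q. p \<in> {1/2..1} \<times> {0..T} \<Longrightarrow> q \<in> {1/2..1} \<times> {0..T} \<Longrightarrow> dist q p < \<delta>
        \<Longrightarrow> dist (R (fst q) (snd q)) (R (fst p) (snd p)) < e"
      using e unfolding uniformly_continuous_on_def by metis
    have "\<forall>\<^sub>F n in sequentially. dist (r n) 1 < \<delta>" using r_lim \<delta>(1) by (rule tendstoD)
    then show "\<forall>\<^sub>F n in sequentially. \<forall>s\<in>{0<..<T}. \<forall>h. norm (R (r n) s * h - R 1 s * h) \<le> e * norm h"
    proof (rule eventually_mono, intro ballI allI)
      fix n s and h :: real assume n: "dist (r n) 1 < \<delta>" and s: "s \<in> {0<..<T}"
      have "dist (R (r n) s) (R 1 s) < e"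
        using \<delta>(2)[of "(1, s)" "(r n, s)"] n s r[of n] by (simp add: dist_Pair_Pair)
      then have "\<bar>R (r n) s - R 1 s\<bar> * \<bar>h\<bar> \<le> e * \<bar>h\<bar>"
        by (intro mult_right_mono) (auto simp: dist_real_def)
      then show "norm (R (r n) s * h - R 1 s * h) \<le> e * norm h"
        by (simp add: abs_mult[symmetric] left_diff_distrib)
    qed
  next
    show "t \<in> {0<..<T}" by (rule t)
  next
    show "(\<lambda>n. W (r n) t) \<longlonglongrightarrow> W 1 t" by (rule W_lim[OF t])
  qed simp
  then obtain g where g: "\<And>s. s \<in> {0<..<T} \<Longrightarrow> (\<lambda>n. W (r n) s) \<longlonglongrightarrow> g s"
    "\<And>s. s \<in> {0<..<T} \<Longrightarrow> (g has_derivative (\<lambda>h. R 1 s * h)) (at s within {0<..<T})" by blast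
  have gW: "g s = G s" if "s \<in> {0<..<T}" for s
    using LIMSEQ_unique[OF g(1)[OF that] W_lim[OF that]] by (simp add: G_eq)
  have "(G has_derivative (\<lambda>h. R 1 t * h)) (at t within {0<..<T})"
    by (rule has_derivative_transform[OF t _ g(2)[OF t]]) (simp add: gW)
  then have "(G has_real_derivative R 1 t) (at t)"
    using t at_within_open[OF t] by (simp add: has_field_derivative_def)
  \<comment> \<open>The boundary terms in \<open>X\<close>, present for every
    \<open>\<rho> < 1\<close>, disappear here by the lateral conditions.\<close>
  moreover have "R 1 t = P 1 - (1 - \<sigma> * \<epsilon>) * m\<^sup>2 * G t"
    using lateral[of t] t by (simp add: R_def X_def G_eq power2_eq_square)
  ultimately show "(G has_real_derivative
      (integral {-pi..pi} (\<lambda>y. f y * sin (m * y + \<theta>)) - (1 - \<sigma> * \<epsilon>) * m\<^sup>2 * G t)) (at t)"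
    by (simp add: P_def)
qed

section \<open>Uniqueness and existence\<close>

lemma continuous_on_time_slice:
  assumes "continuous_on (A \<times> B) (\<lambda>(x, t). w x t)" and "C \<subseteq> A" and "t \<in> B"
  shows "continuous_on C (\<lambda>x. w x t)"
proof -
  have "continuous_on C (\<lambda>x. (\<lambda>(x, t). w x t) (x, t))"
    by (rule continuous_on_compose2[OF assms(1)]) (use assms(2,3) in \<open>auto intro!: continuous_intros\<close>)
  then show ?thesis by simp
qed

lemma regular_solutionD:
  assumes "regular_solution T \<epsilon> \<phi> \<psi> u f"
  shows "continuous_on {-pi..pi} f"
    and "t \<in> {0..T} \<Longrightarrow> continuous_on {-pi..pi} (\<lambda>y. u y t)"
    and "x \<in> {-pi..pi} \<Longrightarrow> u x 0 = \<phi> x" and "x \<in> {-pi..pi} \<Longrightarrow> u x T = \<psi> x"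
proof -
  note sol = assms[unfolded regular_solution_def]
  show "continuous_on {-pi..pi} f" using sol by blast
  show "x \<in> {-pi..pi} \<Longrightarrow> u x 0 = \<phi> x" "x \<in> {-pi..pi} \<Longrightarrow> u x T = \<psi> x"
    using sol by blast+
  have "continuous_on ({-pi..pi} \<times> {0..T}) (\<lambda>(x, t). u x t)" using sol by blast
  then show "t \<in> {0..T} \<Longrightarrow> continuous_on {-pi..pi} (\<lambda>y. u y t)"
    by (rule continuous_on_time_slice) auto
qed

text \<open>The coefficients of both solutions obey equations with the same decay rate and the same
  end values, so their difference falls under \<open>linear_ode_two_point\<close>, with the
  difference of the source coefficients as its constant.\<close>

lemma regular_solution_coefficients_unique:
  assumes sol: "regular_solution T \<epsilon> \<phi> \<psi> u f" "regular_solution T \<epsilon> \<phi> \<psi> v g"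
    and T: "T > 0" and \<epsilon>: "1 - \<sigma> * \<epsilon> > 0" and fam: "trig_family c \<theta>"
    and parity: "\<And>y. sin (- y + \<theta>) = \<sigma> * sin (y + \<theta>)"
  shows "integral {-pi..pi} (\<lambda>y. (f y - g y) * sin ((real k + c) * y + \<theta>)) = 0"
    and "t \<in> {0..T} \<Longrightarrow> integral {-pi..pi} (\<lambda>y. (u y t - v y t) * sin ((real k + c) * y + \<theta>)) = 0"
proof -
  define m where "m = real k + c"
  let ?e = "\<lambda>y. sin (m * y + \<theta>)"
  have m: "m > 0" using fam by (auto simp: m_def trig_family_def)
  note vanish = trig_family_vanish[OF fam, of k, folded m_def]
  define D where "D t = integral {-pi..pi} (\<lambda>y. u y t * ?e y) - integral {-pi..pi} (\<lambda>y. v y t * ?e y)" for t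
  let ?b = "integral {-pi..pi} (\<lambda>y. f y * ?e y) - integral {-pi..pi} (\<lambda>y. g y * ?e y)"
  note ode_u = regular_solution_coefficient_ode[OF sol(1) T vanish parity]
  note ode_v = regular_solution_coefficient_ode[OF sol(2) T vanish parity]
  have D_cont: "continuous_on {0..T} D"
    unfolding D_def by (intro continuous_intros ode_u(1) ode_v(1))
  have D_deriv: "(D has_real_derivative ?b - ((1 - \<sigma> * \<epsilon>) * m\<^sup>2) * D t) (at t)" if "t \<in> {0<..<T}" for t
    unfolding D_def
    by (rule DERIV_cong[OF DERIV_diff[OF ode_u(2)[OF that] ode_v(2)[OF that]]]) (simp add: algebra_simps)
  have D_ends: "D s = 0" if "s = 0 \<or> s = T" for s
  proof -
    have "u y s = v y s" if "y \<in> {-pi..pi}" for y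
      using \<open>s = 0 \<or> s = T\<close> regular_solutionD(3,4)[OF sol(1) that] regular_solutionD(3,4)[OF sol(2) that] by auto
    then have "integral {-pi..pi} (\<lambda>y. u y s * ?e y) = integral {-pi..pi} (\<lambda>y. v y s * ?e y)"
      by (intro integral_cong) simp
    then show ?thesis by (simp add: D_def)
  qed
  have pos: "(1 - \<sigma> * \<epsilon>) * m\<^sup>2 > 0" using \<epsilon> m by simp
  have "?b = 0" by (rule linear_ode_two_point(1)[OF T pos D_cont D_deriv]) (auto intro: D_ends)
  moreover have "integral {-pi..pi} (\<lambda>y. (f y - g y) * ?e y) = ?b"
    unfolding left_diff_distrib
    by (rule integral_diff; intro integrable_continuous_real continuous_intros regular_solutionD(1)[OF sol(1)] regular_solutionD(1)[OF sol(2)])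
  ultimately show "integral {-pi..pi} (\<lambda>y. (f y - g y) * sin ((real k + c) * y + \<theta>)) = 0"
    by (simp add: m_def)
  assume t: "t \<in> {0..T}"
  have "D t = 0" by (rule linear_ode_two_point(2)[OF T pos D_cont D_deriv _ _ t]) (auto intro: D_ends)
  moreover have "integral {-pi..pi} (\<lambda>y. (u y t - v y t) * ?e y) = D t"
    unfolding left_diff_distrib D_def
    by (rule integral_diff; intro integrable_continuous_real continuous_intros regular_solutionD(2)[OF sol(1) t] regular_solutionD(2)[OF sol(2) t])
  ultimately show "integral {-pi..pi} (\<lambda>y. (u y t - v y t) * sin ((real k + c) * y + \<theta>)) = 0"
    by (simp add: m_def)
qed

lemma regular_solution_unique:
  assumes sol: "regular_solution T \<epsilon> \<phi> \<psi> u f" "regular_solution T \<epsilon> \<phi> \<psi> v g"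
    and T: "T > 0" and \<epsilon>: "\<bar>\<epsilon>\<bar> < 1" and x: "x \<in> {-pi..pi}"
  shows "t \<in> {0..T} \<Longrightarrow> u x t = v x t" and "f x = g x"
proof -
  have \<epsilon>': "1 - (-1) * \<epsilon> > 0" "1 - 1 * \<epsilon> > 0" using \<epsilon> by auto
  have parity: "sin (- y + 0) = (-1) * sin (y + 0)" "sin (- y + pi / 2) = 1 * sin (y + pi / 2)" for y :: real
    by (simp, simp only: sin_add_half_pi cos_minus mult_1)
  note sines = regular_solution_coefficients_unique[OF sol T \<epsilon>'(1) trig_familyI(1) parity(1)]
  note cosines = regular_solution_coefficients_unique[OF sol T \<epsilon>'(2) trig_familyI(2) parity(2), unfolded sin_add_half_pi]
  have "f x - g x = 0"
  proof (rule trig_system_complete[OF _ _ _ x])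
    show "continuous_on {-pi..pi} (\<lambda>x. f x - g x)"
      by (intro continuous_intros regular_solutionD(1)[OF sol(1)] regular_solutionD(1)[OF sol(2)])
  qed (use sines(1) cosines(1) in simp_all)
  then show "f x = g x" by simp
  assume t: "t \<in> {0..T}"
  have "u x t - v x t = 0"
  proof (rule trig_system_complete[OF _ _ _ x])
    show "continuous_on {-pi..pi} (\<lambda>x. u x t - v x t)"
      by (intro continuous_intros regular_solutionD(2)[OF sol(1) t] regular_solutionD(2)[OF sol(2) t])
  qed (use sines(2)[OF t] cosines(2)[OF t] in simp_all)
  then show "u x t = v x t" by simp
qed

text \<open>\<open>pdxx\<close> differentiates \<open>pdx u\<close>, which is known to equal
  \<open>ux\<close> only inside the rectangle; as each time slice is open in \<open>x\<close>,
  agreement there suffices.\<close>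

lemma C21_explicit:
  assumes dx: "\<And>x t. (x, t) \<in> Omega T \<Longrightarrow> ((\<lambda>y. u y t) has_real_derivative ux x t) (at x)"
    and dxx: "\<And>x t. (x, t) \<in> Omega T \<Longrightarrow> ((\<lambda>y. ux y t) has_real_derivative uxx x t) (at x)"
    and dt: "\<And>x t. (x, t) \<in> Omega T \<Longrightarrow> ((\<lambda>s. u x s) has_real_derivative ut x t) (at t)"
    and cont: "continuous_on (Omega T) (\<lambda>(x, t). u x t)" "continuous_on (Omega T) (\<lambda>(x, t). ux x t)"
      "continuous_on (Omega T) (\<lambda>(x, t). uxx x t)" "continuous_on (Omega T) (\<lambda>(x, t). ut x t)"
  shows "C21 u (Omega T)"
    and "(x, t) \<in> Omega T \<Longrightarrow> pdxx u x t = uxx x t"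
    and "(x, t) \<in> Omega T \<Longrightarrow> pdt u x t = ut x t"
proof -
  have pdx: "pdx u x t = ux x t" if "(x, t) \<in> Omega T" for x t
    unfolding pdx_def by (rule DERIV_imp_deriv[OF dx[OF that]])
  have dxx': "((\<lambda>y. pdx u y t) has_real_derivative uxx x t) (at x)" if "(x, t) \<in> Omega T" for x t
  proof (rule has_field_derivative_transform_within_open[OF dxx[OF that]])
    show "open {-pi<..<pi}" "x \<in> {-pi<..<pi}" using that by (auto simp: Omega_def)
    show "\<And>y. y \<in> {-pi<..<pi} \<Longrightarrow> ux y t = pdx u y t" using that pdx by (auto simp: Omega_def)
  qed
  have pdxx: "pdxx u x t = uxx x t" if "(x, t) \<in> Omega T" for x t
    unfolding pdxx_def by (rule DERIV_imp_deriv[OF dxx'[OF that]])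
  have pdt: "pdt u x t = ut x t" if "(x, t) \<in> Omega T" for x t
    unfolding pdt_def by (rule DERIV_imp_deriv[OF dt[OF that]])
  show "(x, t) \<in> Omega T \<Longrightarrow> pdxx u x t = uxx x t" "(x, t) \<in> Omega T \<Longrightarrow> pdt u x t = ut x t"
    by (rule pdxx pdt; assumption)+
  show "C21 u (Omega T)"
    unfolding C21_def
  proof (intro conjI)
    show "\<forall>(x, t)\<in>Omega T. (\<lambda>y. u y t) differentiable at x \<and> (\<lambda>y. pdx u y t) differentiable at x \<and> (\<lambda>s. u x s) differentiable at t"
      using dx dxx' dt unfolding real_differentiable_def by blast
    show "continuous_on (Omega T) (\<lambda>(x, t). u x t)" by (rule cont)
    show "continuous_on (Omega T) (\<lambda>(x, t). pdx u x t)"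
      by (rule continuous_on_eq[OF cont(2)]) (auto simp: pdx)
    show "continuous_on (Omega T) (\<lambda>(x, t). pdxx u x t)"
      by (rule continuous_on_eq[OF cont(3)]) (auto simp: pdxx)
    show "continuous_on (Omega T) (\<lambda>(x, t). pdt u x t)"
      by (rule continuous_on_eq[OF cont(4)]) (auto simp: pdt)
  qed
qed

lemma mode_coef_diff:
  assumes "g measurable_on {-pi..pi}" "(\<lambda>x. (g x)\<^sup>2) integrable_on {-pi..pi}"
    and "h measurable_on {-pi..pi}" "(\<lambda>x. (h x)\<^sup>2) integrable_on {-pi..pi}"
  shows "mode_coef c \<theta> (\<lambda>x. g x - h x) k = mode_coef c \<theta> g k - mode_coef c \<theta> h k"
proof -
  have "(\<lambda>x. w x * cos ((real k + c) * x + \<theta>)) integrable_on {-pi..pi}"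
    if "w measurable_on {-pi..pi}" "(\<lambda>x. (w x)\<^sup>2) integrable_on {-pi..pi}" for w
    using absolutely_integrable_times_continuous[OF square_integrable_imp_absolutely_integrable[OF that]]
    by (simp add: absolutely_integrable_on_def continuous_intros)
  then show ?thesis
    unfolding mode_coef_def left_diff_distrib using assms by (simp add: integral_diff right_diff_distrib)
qed

theorem theorem1:
  fixes T \<epsilon> :: real and \<phi> \<phi>1 \<phi>2 \<phi>3 \<psi> \<psi>1 \<psi>2 \<psi>3 :: "real \<Rightarrow> real"
  assumes "T > 0" and "\<epsilon> \<noteq> 0" and "\<bar>\<epsilon>\<bar> < 1"
    and "C2_L2_third \<phi> \<phi>1 \<phi>2 \<phi>3" and "C2_L2_third \<psi> \<psi>1 \<psi>2 \<psi>3"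
    and "\<phi> (-pi) = 0" "\<phi> pi = 0" "\<phi>2 (-pi) = 0" "\<phi>2 pi = 0"
    and "\<psi> (-pi) = 0" "\<psi> pi = 0" "\<psi>2 (-pi) = 0" "\<psi>2 pi = 0"
  shows "(\<forall>x\<in>{-pi..pi}. \<forall>t\<in>{0..T}.
            summable (\<lambda>k. uterm1 T \<epsilon> \<phi>3 \<psi>3 x t (Suc k)) \<and> summable (uterm2 T \<epsilon> \<phi>3 \<psi>3 x t))
       \<and> (\<forall>x\<in>{-pi..pi}.
            summable (\<lambda>k. fterm1 T \<epsilon> \<phi>3 \<psi>3 x (Suc k)) \<and> summable (fterm2 T \<epsilon> \<phi>3 \<psi>3 x))
       \<and> regular_solution T \<epsilon> \<phi> \<psi> (u_sol T \<epsilon> \<phi> \<phi>3 \<psi>3) (f_sol T \<epsilon> \<phi>2 \<phi>3 \<psi>3)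
       \<and> (\<forall>u f. regular_solution T \<epsilon> \<phi> \<psi> u f \<longrightarrow>
            (\<forall>x\<in>{-pi..pi}. \<forall>t\<in>{0..T}. u x t = u_sol T \<epsilon> \<phi> \<phi>3 \<psi>3 x t)
            \<and> (\<forall>x\<in>{-pi..pi}. f x = f_sol T \<epsilon> \<phi>2 \<phi>3 \<psi>3 x))"
proof -
  have \<phi>_deriv: "\<And>x. x \<in> {-pi..pi} \<Longrightarrow> (\<phi> has_real_derivative \<phi>1 x) (at x within {-pi..pi})"
      "\<And>x. x \<in> {-pi..pi} \<Longrightarrow> (\<phi>1 has_real_derivative \<phi>2 x) (at x within {-pi..pi})"
    and \<phi>2_cont: "continuous_on {-pi..pi} \<phi>2"
    and \<phi>3: "\<phi>3 measurable_on {-pi..pi}" "(\<lambda>x. (\<phi>3 x)\<^sup>2) integrable_on {-pi..pi}"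
    using assms(4) unfolding C2_L2_third_def by blast+
  have \<psi>_deriv: "\<And>x. x \<in> {-pi..pi} \<Longrightarrow> (\<psi> has_real_derivative \<psi>1 x) (at x within {-pi..pi})"
    and \<psi>3: "\<psi>3 measurable_on {-pi..pi}" "(\<lambda>x. (\<psi>3 x)\<^sup>2) integrable_on {-pi..pi}"
    using assms(5) unfolding C2_L2_third_def by blast+
  have \<phi>_cont: "continuous_on {-pi..pi} \<phi>" and \<phi>1_cont: "continuous_on {-pi..pi} \<phi>1"
    and \<psi>_cont: "continuous_on {-pi..pi} \<psi>"
    by (rule DERIV_continuous_on[OF \<phi>_deriv(1)] DERIV_continuous_on[OF \<phi>_deriv(2)] DERIV_continuous_on[OF \<psi>_deriv]; assumption)+
  have interior: "at x within {-pi..pi} = at x" if "x \<in> {-pi<..<pi}" for x :: real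
    using that by (intro at_within_interior) auto

  define d where "d c \<theta> = mode_coef c \<theta> (\<lambda>x. \<phi>3 x - \<psi>3 x)" for c \<theta>
  have d_eq: "d c \<theta> k = mode_coef c \<theta> \<phi>3 k - mode_coef c \<theta> \<psi>3 k" for c \<theta> k
    unfolding d_def by (rule mode_coef_diff[OF \<phi>3 \<psi>3])
  have d_sum: "summable (\<lambda>k. \<bar>d c \<theta> k\<bar> / (real k + c))" if "trig_family c \<theta>" for c \<theta>
    unfolding d_def by (rule mode_coef_summable[OF that square_integrable_diff[OF \<phi>3 \<psi>3]])
  interpret S1: mode_series "1 + \<epsilon>" T 1 0 "d 1 0"
    using assms(1,3) by unfold_locales (auto intro: trig_familyI d_sum)
  interpret S2: mode_series "1 - \<epsilon>" T "1/2" "pi/2" "d (1/2) (pi/2)"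
    using assms(1,3) by unfold_locales (auto intro: trig_familyI d_sum)

  have terms1: "uterm1 T \<epsilon> \<phi>3 \<psi>3 x t (Suc k) = S1.U k x t" "fterm1 T \<epsilon> \<phi>3 \<psi>3 x (Suc k) = S1.F k x" for x t k
    unfolding uterm1_def fterm1_def Let_def coef1_eq d_eq[symmetric] S1.U_def S1.F_def S1.amp_def S1.den_def S1.freq_def
    by (simp_all add: add.commute)
  have "coef2 \<phi>3 (real k) - coef2 \<psi>3 (real k) = - d (1/2) (pi/2) k" for k
    unfolding coef2_eq d_eq by simp
  then have terms2: "uterm2 T \<epsilon> \<phi>3 \<psi>3 x t k = - S2.U k x t" "fterm2 T \<epsilon> \<phi>3 \<psi>3 x k = - S2.F k x" for x t k
    unfolding uterm2_def fterm2_def Let_def S2.U_def S2.F_def S2.amp_def S2.den_def S2.freq_def sin_add_half_pi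
    by simp_all
  have terms2': "uterm2 T \<epsilon> \<phi>3 \<psi>3 x t = (\<lambda>k. - S2.U k x t)" "fterm2 T \<epsilon> \<phi>3 \<psi>3 x = (\<lambda>k. - S2.F k x)" for x t
    by (simp_all add: terms2 fun_eq_iff)

  define v where "v x t = \<phi> x + S1.u x t + S2.u x t" for x t
  \<comment> \<open>Pulling the sign out of the second series requires its convergence, which is
    available for nonnegative times.\<close>
  have u_sol: "u_sol T \<epsilon> \<phi> \<phi>3 \<psi>3 x t = v x t" if "t \<ge> 0" for x t
    unfolding u_sol_def terms1 terms2 v_def S1.u_def S2.u_def
    using S2.summables(1)[OF that, of x] by (simp add: suminf_minus)
  have f_sol: "f_sol T \<epsilon> \<phi>2 \<phi>3 \<psi>3 x = - \<phi>2 x + \<epsilon> * \<phi>2 (- x) + S1.f x + S2.f x" for x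
    unfolding f_sol_def terms1 terms2 S1.f_def S2.f_def
    using S2.summables(5)[of x] by (simp add: suminf_minus)

  have comp: "continuous_on (A \<times> B) (\<lambda>(x, t). h x)" if "continuous_on A h" for A :: "real set" and B :: "real set" and h :: "real \<Rightarrow> real"
    unfolding case_prod_beta by (rule continuous_on_compose2[OF that]) (auto intro!: continuous_intros)
  have sum3: "continuous_on (A \<times> B) (\<lambda>(x, t). h x + p x t + q x t)"
    if "continuous_on {-pi..pi} h" "continuous_on (UNIV \<times> {0..}) (\<lambda>(x, t). p x t)" "continuous_on (UNIV \<times> {0..}) (\<lambda>(x, t). q x t)"
      "A \<subseteq> {-pi..pi}" "B \<subseteq> {0..}" for A B :: "real set" and h :: "real \<Rightarrow> real" and p q :: "real \<Rightarrow> real \<Rightarrow> real"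
  proof -
    have "A \<times> B \<subseteq> UNIV \<times> {0..}" using that by auto
    then show ?thesis
      using comp[OF continuous_on_subset[OF that(1,4)], of B] that(2,3)[THEN continuous_on_subset]
      unfolding case_prod_beta by (intro continuous_intros) auto
  qed

  have v_cont: "continuous_on ({-pi..pi} \<times> {0..T}) (\<lambda>(x, t). v x t)"
    unfolding v_def by (rule sum3[OF \<phi>_cont S1.continuous_sums(1) S2.continuous_sums(1)]) auto
  \<comment> \<open>All coefficients of the continuous function \<open>v x T - \<psi> x\<close>
    vanish: on each family one of the two series contributes the coefficient of
    \<open>\<psi> - \<phi>\<close>, and the other is orthogonal to it.\<close>
  have v_final: "v x T = \<psi> x" if x: "x \<in> {-pi..pi}" for x
  proof -
    have slices: "continuous_on {-pi..pi} (\<lambda>x. S1.u x T)" "continuous_on {-pi..pi} (\<lambda>x. S2.u x T)"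
      using assms(1) by (auto intro: continuous_on_time_slice[OF S1.continuous_sums(1)] continuous_on_time_slice[OF S2.continuous_sums(1)])
    have split: "integral {-pi..pi} (\<lambda>x. (v x T - \<psi> x) * e x) =
        integral {-pi..pi} (\<lambda>x. \<phi> x * e x) - integral {-pi..pi} (\<lambda>x. \<psi> x * e x)
        + integral {-pi..pi} (\<lambda>x. S1.u x T * e x) + integral {-pi..pi} (\<lambda>x. S2.u x T * e x)"
      if e: "continuous_on {-pi..pi} e" for e
    proof -
      have i: "(\<lambda>x. h x * e x) integrable_on {-pi..pi}" if "continuous_on {-pi..pi} h" for h
        by (intro integrable_continuous_real continuous_intros that e)
      note ints = i[OF \<phi>_cont] i[OF \<psi>_cont] i[OF slices(1)] i[OF slices(2)]
      have "integral {-pi..pi} (\<lambda>x. (v x T - \<psi> x) * e x)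
        = integral {-pi..pi} (\<lambda>x. (\<phi> x * e x - \<psi> x * e x) + S1.u x T * e x + S2.u x T * e x)"
        by (simp add: v_def algebra_simps)
      then show ?thesis using ints by (simp add: integral_add integral_diff integrable_add integrable_diff)
    qed
    have coef: "pi * (d c \<theta> k / (real k + c) ^ 3) =
        integral {-pi..pi} (\<lambda>x. \<psi> x * sin ((real k + c) * x + \<theta>)) - integral {-pi..pi} (\<lambda>x. \<phi> x * sin ((real k + c) * x + \<theta>))"
      if fam: "trig_family c \<theta>" for c \<theta> k
    proof -
      have pos: "real k + c > 0" using fam by (auto simp: trig_family_def)
      have "pi * d c \<theta> k = (real k + c) ^ 3 * (integral {-pi..pi} (\<lambda>x. \<psi> x * sin ((real k + c) * x + \<theta>)) - integral {-pi..pi} (\<lambda>x. \<phi> x * sin ((real k + c) * x + \<theta>)))"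
        using mode_coef_third_derivative[OF fam assms(4,6,7,8,9), of k] mode_coef_third_derivative[OF fam assms(5,10,11,12,13), of k]
        by (simp add: d_eq right_diff_distrib)
      then show ?thesis using pos by (simp add: field_simps)
    qed
    have "v x T - \<psi> x = 0"
    proof (rule trig_system_complete[OF _ _ _ x])
      show "continuous_on {-pi..pi} (\<lambda>x. v x T - \<psi> x)"
        unfolding v_def by (intro continuous_intros \<phi>_cont \<psi>_cont slices)
    next
      fix k
      let ?e = "\<lambda>x. sin ((real k + 1) * x + 0)"
      have "integral {-pi..pi} (\<lambda>x. S1.u x T * ?e x) = pi * (d 1 0 k / (real k + 1) ^ 3)"
        using S1.u_integral_final[of k] by (simp only: S1.freq_def)
      moreover have "integral {-pi..pi} (\<lambda>x. S2.u x T * ?e x) = 0"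
        by (rule S2.u_integral_orthogonal)
          (use assms(1) trig_families_cross_orthogonal(2) in \<open>auto simp only: S2.freq_def less_imp_le intro!: continuous_intros\<close>)
      ultimately have "integral {-pi..pi} (\<lambda>x. (v x T - \<psi> x) * ?e x) = 0"
        using split[of ?e] coef[OF trig_familyI(1), of k] by (simp add: continuous_intros)
      then show "integral {-pi..pi} (\<lambda>x. (v x T - \<psi> x) * sin ((real k + 1) * x)) = 0" by simp
    next
      fix k
      let ?e = "\<lambda>x. sin ((real k + 1/2) * x + pi / 2)"
      have "integral {-pi..pi} (\<lambda>x. S2.u x T * ?e x) = pi * (d (1/2) (pi/2) k / (real k + 1/2) ^ 3)"
        using S2.u_integral_final[of k] by (simp only: S2.freq_def)
      moreover have "integral {-pi..pi} (\<lambda>x. S1.u x T * ?e x) = 0"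
        by (rule S1.u_integral_orthogonal)
          (use assms(1) trig_families_cross_orthogonal(1) in \<open>auto simp only: S1.freq_def less_imp_le intro!: continuous_intros\<close>)
      moreover have "continuous_on {-pi..pi} ?e" by (auto intro!: continuous_intros)
      ultimately have "integral {-pi..pi} (\<lambda>x. (v x T - \<psi> x) * ?e x) = 0"
        using split[of ?e] coef[OF trig_familyI(2), of k] by linarith
      then show "integral {-pi..pi} (\<lambda>x. (v x T - \<psi> x) * cos ((real k + 1/2) * x)) = 0"
        by (simp only: sin_add_half_pi)
    qed
    then show ?thesis by simp
  qed

  let ?u = "u_sol T \<epsilon> \<phi> \<phi>3 \<psi>3" and ?f = "f_sol T \<epsilon> \<phi>2 \<phi>3 \<psi>3"
  let ?ux = "\<lambda>x t. \<phi>1 x + S1.ux x t + S2.ux x t"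
  let ?uxx = "\<lambda>x t. \<phi>2 x + S1.uxx x t + S2.uxx x t"
  let ?ut = "\<lambda>x t. S1.ut x t + S2.ut x t"
  have in_Omega: "x \<in> {-pi<..<pi}" "x \<in> {-pi..pi}" "t > 0" "t \<ge> 0" if "(x, t) \<in> Omega T" for x t
    using that by (auto simp: Omega_def)
  have dx: "((\<lambda>y. ?u y t) has_real_derivative ?ux x t) (at x)" if "(x, t) \<in> Omega T" for x t
    unfolding u_sol[OF in_Omega(4)[OF that]] v_def
    using \<phi>_deriv(1)[OF in_Omega(2)[OF that]] interior[OF in_Omega(1)[OF that]]
    by (auto intro!: derivative_eq_intros S1.u_deriv_x S2.u_deriv_x in_Omega(4)[OF that])
  have dxx: "((\<lambda>y. ?ux y t) has_real_derivative ?uxx x t) (at x)" if "(x, t) \<in> Omega T" for x t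
    using \<phi>_deriv(2)[OF in_Omega(2)[OF that]] interior[OF in_Omega(1)[OF that]]
    by (auto intro!: derivative_eq_intros S1.ux_deriv_x S2.ux_deriv_x in_Omega(4)[OF that])
  have dt: "((\<lambda>s. ?u x s) has_real_derivative ?ut x t) (at t)" if "(x, t) \<in> Omega T" for x t
  \<comment> \<open>The formula agrees with \<open>v\<close> only for nonnegative times, so the
    derivative is transferred on the open half-line.\<close>
  proof (rule has_field_derivative_transform_within_open)
    show "((\<lambda>s. v x s) has_real_derivative ?ut x t) (at t)"
      unfolding v_def by (auto intro!: derivative_eq_intros S1.u_deriv_t S2.u_deriv_t in_Omega(3)[OF that])
    show "open {0::real<..}" "t \<in> {0<..}" using in_Omega(3)[OF that] by auto
    show "\<And>s. s \<in> {0<..} \<Longrightarrow> v x s = ?u x s" by (simp add: u_sol)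
  qed
  have u_cont: "continuous_on ({-pi..pi} \<times> {0..T}) (\<lambda>(x, t). ?u x t)"
    by (rule continuous_on_eq[OF v_cont]) (auto simp: u_sol)
  have sub: "Omega T \<subseteq> {-pi..pi} \<times> {0..T}" by (auto simp: Omega_def)
  have conts: "continuous_on (Omega T) (\<lambda>(x, t). ?ux x t)" "continuous_on (Omega T) (\<lambda>(x, t). ?uxx x t)"
    unfolding Omega_def
    by (rule sum3[OF \<phi>1_cont S1.continuous_sums(2) S2.continuous_sums(2)]; force)
       (rule sum3[OF \<phi>2_cont S1.continuous_sums(3) S2.continuous_sums(3)]; force)
  have cont_t: "continuous_on (Omega T) (\<lambda>(x, t). ?ut x t)"
    using sum3[OF continuous_on_const[of _ 0] S1.continuous_sums(4) S2.continuous_sums(4), of "{-pi<..<pi}" "{0<..<T}"]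
    unfolding Omega_def by force
  have C21: "C21 ?u (Omega T)" "\<And>x t. (x, t) \<in> Omega T \<Longrightarrow> pdxx ?u x t = ?uxx x t"
    "\<And>x t. (x, t) \<in> Omega T \<Longrightarrow> pdt ?u x t = ?ut x t"
    using C21_explicit[OF dx dxx dt continuous_on_subset[OF u_cont sub] conts cont_t] by blast+

  have regular: "regular_solution T \<epsilon> \<phi> \<psi> ?u ?f"
    unfolding regular_solution_def
  proof (intro conjI ballI)
    show "C21 ?u (Omega T)" by (rule C21(1))
    show "continuous_on ({-pi..pi} \<times> {0..T}) (\<lambda>(x, t). ?u x t)" by (rule u_cont)
    have "continuous_on {-pi..pi} (\<lambda>x. \<phi>2 (- x))"
      by (rule continuous_on_compose2[OF \<phi>2_cont]) (auto intro!: continuous_intros)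
    then show "continuous_on {-pi..pi} ?f"
      unfolding f_sol
      by (intro continuous_intros \<phi>2_cont S1.continuous_sums(5)[THEN continuous_on_subset] S2.continuous_sums(5)[THEN continuous_on_subset]) auto
    show "case p of (x, t) \<Rightarrow> pdt ?u x t - pdxx ?u x t + \<epsilon> * pdxx ?u (- x) t = ?f x" if "p \<in> Omega T" for p
    proof (cases p)
      case (Pair x t)
      then have xt: "(x, t) \<in> Omega T" "(- x, t) \<in> Omega T" using that by (auto simp: Omega_def)
      \<comment> \<open>These signs combine \<open>- u_xx(x) + \<epsilon> u_xx(-x)\<close> into
        \<open>-(1 + \<epsilon>)\<close> and \<open>-(1 - \<epsilon>)\<close> times the second
        derivatives of the two series, matching their heat equations.\<close>
      have "S1.uxx (- x) t = - 1 * S1.uxx x t" by (rule S1.uxx_reflect) (use in_Omega(4)[OF xt(1)] in auto)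
      moreover have "S2.uxx (- x) t = 1 * S2.uxx x t"
        by (rule S2.uxx_reflect) (use in_Omega(4)[OF xt(1)] in \<open>simp_all only: sin_add_half_pi cos_minus mult_1\<close>)
      moreover have "S1.ut x t = S1.f x + (1 + \<epsilon>) * S1.uxx x t" "S2.ut x t = S2.f x + (1 - \<epsilon>) * S2.uxx x t"
        using S1.heat_equation[OF in_Omega(4)[OF xt(1)], of x] S2.heat_equation[OF in_Omega(4)[OF xt(1)], of x]
        by linarith+
      ultimately have "pdt ?u x t - pdxx ?u x t + \<epsilon> * pdxx ?u (- x) t = ?f x"
        unfolding C21(2)[OF xt(1)] C21(2)[OF xt(2)] C21(3)[OF xt(1)] f_sol
        by (simp only:) (simp add: algebra_simps)
      then show ?thesis by (simp add: Pair)
    qed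
    show "?u x 0 = \<phi> x" if "x \<in> {-pi..pi}" for x
      by (simp add: u_sol v_def S1.u_initial S2.u_initial)
    show "?u x T = \<psi> x" if "x \<in> {-pi..pi}" for x
      using assms(1) v_final[OF that] by (simp add: u_sol)
    show "?u (- pi) t = 0" "?u pi t = 0" if "t \<in> {0..T}" for t
      using that assms(6,7) by (simp_all add: u_sol v_def S1.u_boundary S2.u_boundary)
  qed
  have sums: "summable (\<lambda>k. uterm1 T \<epsilon> \<phi>3 \<psi>3 x t (Suc k)) \<and> summable (uterm2 T \<epsilon> \<phi>3 \<psi>3 x t)"
    if "t \<in> {0..T}" for x t
    unfolding terms1 terms2' using that by (auto intro!: summable_minus S1.summables S2.summables)
  have f_sums: "summable (\<lambda>k. fterm1 T \<epsilon> \<phi>3 \<psi>3 x (Suc k)) \<and> summable (fterm2 T \<epsilon> \<phi>3 \<psi>3 x)" for x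
    unfolding terms1 terms2' by (auto intro!: summable_minus S1.summables S2.summables)
  show ?thesis
  proof (intro conjI ballI allI impI)
    fix u f x t assume sol: "regular_solution T \<epsilon> \<phi> \<psi> u f" and x: "x \<in> {-pi..pi}"
    show "u x t = ?u x t" if "t \<in> {0..T}"
      by (rule regular_solution_unique(1)[OF sol regular assms(1,3) x that])
    show "f x = ?f x"
      by (rule regular_solution_unique(2)[OF sol regular assms(1,3) x])
  qed (use sums f_sums regular in blast)+
qed

end
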